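(* Let $n\geq 1$ be an integer, $s\geq 0$ real, and let $u$ be the solution of the Cauchy problem $u_{tt}-\Delta u=0$ in $(0,\infty)\times\mathbb{R}^n$, $(u,u_t)(0,\cdot)=(u_0,u_1)$. For $n>2s$ put $$D_{n,s}(t):=\begin{cases} t^{1+s-\frac n2} & \text{if } 2s<n<2+2s,\\ \sqrt{\ln t} & \text{if } n=2+2s,\\ 1 & \text{if } n>2+2s.\end{cases}$$ (i) (Upper bound.) If $0\leq s<\frac n2$, there are constants $C,T>0$ depending only on $n,s$ such that whenever $u_0\in L^2$ and $\nabla^s u_1\in L^2\cap L^1$, $$\|u(t,\cdot)\|_{L^2}\leq C\,D_{n,s}(t)\,\big(\|u_0\|_{L^2}+\|\nabla^s u_1\|_{L^2\cap L^1}\big)\qquad\text{for all } t\geq T.$$ (ii) (Lower bound.) If $0\leq s<\frac n2$, $u_0\in L^2\cap L^1$, $\nabla^s u_1\in L^2\cap L^{1,1}$ and $P_{\nabla^s u_1}\neq 0$, then there are $c,T>0$ independent of $t$ (possibly depending on $n,s$ and the data) such that $$\|u(t,\cdot)\|_{L^2}\geq c\,D_{n,s}(t)\,|P_{\nabla^s u_1}|\qquad\text{for all } t\geq T.$$ (iii) (Blow-up.) If $s\geq \frac n2$, $u_0\in L^2$, $\nabla^s u_1\in L^{1,1}$ and $P_{\nabla^s u_1}\neq 0$, then for every $t_0>0$ one has $\|u(t,\cdot)\|_{L^2}=+\infty$ for all $t\in(0,t_0]$.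
   Context: All function spaces are over $\mathbb{R}^n$; $\hat f$ is the Fourier transform. $L^{1,\kappa}:=\{f\in L^1:\|f\|_{L^{1,\kappa}}:=\|(1+|x|)^\kappa f\|_{L^1}<\infty\}$ for $\kappa\geq0$; $\|f\|_{X\cap Y}=\|f\|_X+\|f\|_Y$. For real $s\geq0$, $\nabla^s$ is the Fourier multiplier with symbol $|\xi|^s$: "$\nabla^s u_1\in X$" means that $\hat u_1$ is a measurable function such that $|\xi|^s\hat u_1(\xi)$ is the Fourier transform of a function in $X$, denoted $\nabla^s u_1$. $P_f:=\int_{\mathbb{R}^n}f(x)\,dx$. The solution is understood through its Fourier representation $\hat u(t,\xi)=\cos(|\xi|t)\,\hat u_0(\xi)+\frac{\sin(|\xi|t)}{|\xi|}\hat u_1(\xi)$, and $\|u(t,\cdot)\|_{L^2}\in[0,+\infty]$ is computed from $\hat u(t,\cdot)$ by Plancherel. *)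

theory Defs
  imports "HOL-Analysis.Analysis"
begin

text \<open>
  All functions are complex-valued and Lebesgue measurable. The norms take values in
  \<open>[0,\<infinity>]\<close>, i.e. in \<^typ>\<open>ennreal\<close>, so that \<open>\<infinity>\<close> is a genuine value.
\<close>

definition ennreal_sqrt :: "ennreal \<Rightarrow> ennreal" where
  "ennreal_sqrt a = (if a = \<infinity> then \<infinity> else ennreal (sqrt (enn2real a)))"

definition L2norm :: "('a::euclidean_space \<Rightarrow> complex) \<Rightarrow> ennreal" where
  "L2norm f = ennreal_sqrt (\<integral>\<^sup>+ x. ennreal ((cmod (f x))\<^sup>2) \<partial>lebesgue)"

definition L1norm :: "('a::euclidean_space \<Rightarrow> complex) \<Rightarrow> ennreal" where
  "L1norm f = (\<integral>\<^sup>+ x. ennreal (cmod (f x)) \<partial>lebesgue)"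

definition wL1norm :: "real \<Rightarrow> ('a::euclidean_space \<Rightarrow> complex) \<Rightarrow> ennreal" where
  "wL1norm \<kappa> f = L1norm (\<lambda>x. complex_of_real ((1 + norm x) powr \<kappa>) * f x)"

definition L2 :: "('a::euclidean_space \<Rightarrow> complex) set" where
  "L2 = {f \<in> borel_measurable lebesgue. L2norm f < \<infinity>}"

definition L1 :: "('a::euclidean_space \<Rightarrow> complex) set" where
  "L1 = {f \<in> borel_measurable lebesgue. L1norm f < \<infinity>}"

definition wL1 :: "real \<Rightarrow> ('a::euclidean_space \<Rightarrow> complex) set" where
  "wL1 \<kappa> = {f \<in> L1. wL1norm \<kappa> f < \<infinity>}"

definition total_integral :: "('a::euclidean_space \<Rightarrow> complex) \<Rightarrow> complex" where
  "total_integral f = (LINT x|lebesgue. f x)"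

text \<open>
  The Fourier transform is not normalised: \<open>\<integral> exp (- i x \<cdot> \<xi>) f x dx\<close>. Hence Plancherel's
  identity reads \<open>\<parallel>f\<parallel> = (2 \<pi>) powr (- n / 2) \<cdot> \<parallel>Ff\<parallel>\<close>, which explains the factor in
  \<open>plancherel_norm\<close> below. The integral is meaningful for \<open>f \<in> L1\<close>; on \<open>L2\<close> the transform is
  the limit in mean square of the transforms of the truncations of \<open>f\<close> to balls. It is
  determined up to a null set, and \<open>fourier_L2\<close> picks a representative.
\<close>

definition fourier :: "('a::euclidean_space \<Rightarrow> complex) \<Rightarrow> 'a \<Rightarrow> complex" where
  "fourier f \<xi> = (LINT x|lebesgue. exp (- (\<i> * complex_of_real (x \<bullet> \<xi>))) * f x)"

definition has_fourier_L2 :: "('a::euclidean_space \<Rightarrow> complex) \<Rightarrow> ('a \<Rightarrow> complex) \<Rightarrow> bool" where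
  "has_fourier_L2 f g \<longleftrightarrow> g \<in> L2 \<and>
     (\<lambda>k::nat. L2norm (\<lambda>\<xi>. fourier (\<lambda>x. indicator (cball 0 (real k)) x * f x) \<xi> - g \<xi>))
       \<longlonglongrightarrow> 0"

definition fourier_L2 :: "('a::euclidean_space \<Rightarrow> complex) \<Rightarrow> 'a \<Rightarrow> complex" where
  "fourier_L2 f = (SOME g. has_fourier_L2 f g)"

definition plancherel_norm :: "('a::euclidean_space \<Rightarrow> complex) \<Rightarrow> ennreal" where
  "plancherel_norm g = ennreal ((2 * pi) powr (- real DIM('a) / 2)) * L2norm g"

text \<open>
  The datum \<open>u\<^sub>1\<close> need not be a function; it is given by its Fourier transform \<open>v\<close>, a measurable
  function. \<open>has_nabla s v w\<close> states that \<open>w \<in> L1\<close> is \<open>\<nabla>\<^sup>s u\<^sub>1\<close>; \<open>w\<close> is determined by \<open>v\<close> up to a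
  null set. The value at \<open>\<xi> = 0\<close>, where \<open>0 powr 0 = 0\<close>, is irrelevant here; so is the value
  \<open>x / 0 = 0\<close> in \<open>wave_hat\<close>.
\<close>

definition has_nabla :: "real \<Rightarrow> ('a::euclidean_space \<Rightarrow> complex) \<Rightarrow> ('a \<Rightarrow> complex) \<Rightarrow> bool" where
  "has_nabla s v w \<longleftrightarrow> v \<in> borel_measurable lebesgue \<and> w \<in> L1 \<and>
     (AE \<xi> in lebesgue. complex_of_real (norm \<xi> powr s) * v \<xi> = fourier w \<xi>)"

text \<open>\<open>wave_hat u\<^sub>0 v t\<close> is the Fourier transform in space of the solution at time \<open>t\<close> with data
  \<open>u\<^sub>0\<close> and \<open>u\<^sub>1\<close>, where \<open>v\<close> is the Fourier transform of \<open>u\<^sub>1\<close>.\<close>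

definition wave_hat ::
    "('a::euclidean_space \<Rightarrow> complex) \<Rightarrow> ('a \<Rightarrow> complex) \<Rightarrow> real \<Rightarrow> 'a \<Rightarrow> complex" where
  "wave_hat u\<^sub>0 v t \<xi> = complex_of_real (cos (norm \<xi> * t)) * fourier_L2 u\<^sub>0 \<xi>
     + complex_of_real (sin (norm \<xi> * t) / norm \<xi>) * v \<xi>"

definition wave_L2norm ::
    "('a::euclidean_space \<Rightarrow> complex) \<Rightarrow> ('a \<Rightarrow> complex) \<Rightarrow> real \<Rightarrow> ennreal" where
  "wave_L2norm u\<^sub>0 v t = plancherel_norm (wave_hat u\<^sub>0 v t)"

text \<open>Only used for \<open>2 * s < n\<close>.\<close>

definition D_rate :: "nat \<Rightarrow> real \<Rightarrow> real \<Rightarrow> real" where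
  "D_rate n s t =
     (if real n < 2 + 2 * s then t powr (1 + s - real n / 2)
      else if real n = 2 + 2 * s then sqrt (ln t)
      else 1)"

end

theory Submission
  imports Defs "HOL-Probability.Characteristic_Functions"
begin

text \<open>
  Since \<open>|a + b|\<^sup>2 \<le> 2|a|\<^sup>2 + 2|b|\<^sup>2\<close>, the contribution of \<open>u\<^sub>0\<close> can be split off, and everything
  reduces to the size of \<open>sin\<^sup>2 (t|\<xi>|) |\<xi>| powr (- 2 - 2 s) |Fw \<xi>|\<^sup>2\<close>, where \<open>w = \<nabla>\<^sup>s u\<^sub>1\<close>. For
  \<open>|\<xi>| \<ge> 1\<close> the factor in front of \<open>|Fw|\<^sup>2\<close> is at most \<open>1\<close> and Plancherel applies; for small
  \<open>|\<xi>|\<close> the transform \<open>Fw\<close> is bounded above by the \<open>L\<^sup>1\<close> norm and, near the origin, below by half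
  of \<open>|Fw 0| = |P|\<close>. What remains is the one-dimensional integral of
  \<open>sin\<^sup>2 (t r) r powr (n - 3 - 2 s)\<close> near \<open>r = 0\<close>, whose growth in \<open>t\<close> is the square of the rate, and
  which diverges for \<open>2 s \<ge> n\<close>. In the lower bound the part of \<open>u\<^sub>0\<close> on a ball of radius \<open>r\<close> is
  \<open>O(r\<^sup>n)\<close> because \<open>u\<^sub>0 \<in> L\<^sup>1\<close>; it is absorbed by letting \<open>t\<close> be large or, when the rate is
  constant, \<open>r\<close> small.

  Only the inequality half of Plancherel's theorem is needed. The integral of \<open>|Ff|\<^sup>2\<close> against a
  Gaussian is a double integral of \<open>f x (cnj (f y))\<close> against a positive convolution kernel of total
  mass \<open>(2 \<pi>)\<^sup>n\<close>; Schur's test bounds it, and the Gaussian is then widened with Fatou's lemma.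
\<close>

section \<open>Plancherel's inequality\<close>

text \<open>\<open>lborel\<close> is the image of the product of one-dimensional Lebesgue measures
  under summing coordinates, so this is Fubini for tensor products. The factors are complex because
  they will carry phases.\<close>

lemma
  fixes f :: "'a::euclidean_space \<Rightarrow> real \<Rightarrow> complex"
  assumes f: "\<And>b. b \<in> Basis \<Longrightarrow> integrable lborel (f b)"
  shows integrable_lborel_prod: "integrable lborel (\<lambda>x::'a. \<Prod>b\<in>Basis. f b (x \<bullet> b))"
    and integral_lborel_prod:
      "(\<integral>x. (\<Prod>b\<in>Basis. f b (x \<bullet> b)) \<partial>lborel) = (\<Prod>b\<in>Basis. \<integral>y. f b y \<partial>lborel)"
proof -
  interpret product_sigma_finite "\<lambda>_::'a. lborel :: real measure"
    by standard
  have m[measurable]: "\<And>b. b \<in> Basis \<Longrightarrow> f b \<in> borel_measurable borel"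
    using f borel_measurable_integrable by fastforce
  have e: "(\<Prod>b\<in>Basis. f b ((\<Sum>b\<in>Basis. x b *\<^sub>R b) \<bullet> b)) = (\<Prod>b\<in>Basis. f b (x b))" for x
    by (intro prod.cong) auto
  have "integrable (\<Pi>\<^sub>M b\<in>(Basis::'a set). lborel) (\<lambda>x. \<Prod>b\<in>Basis. f b (x b))"
    using f by (intro product_integrable_prod) auto
  then show "integrable lborel (\<lambda>x::'a. \<Prod>b\<in>Basis. f b (x \<bullet> b))"
    by (subst lborel_eq, subst integrable_distr_eq) (auto simp: e)
  have "(\<integral>x. (\<Prod>b\<in>Basis. f b (x b)) \<partial>(\<Pi>\<^sub>M b\<in>(Basis::'a set). lborel)) = (\<Prod>b\<in>Basis. \<integral>y. f b y \<partial>lborel)"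
    using f by (intro product_integral_prod) auto
  then show "(\<integral>x. (\<Prod>b\<in>Basis. f b (x \<bullet> b)) \<partial>lborel) = (\<Prod>b\<in>Basis. \<integral>y. f b y \<partial>lborel)"
    by (subst lborel_eq, subst integral_distr) (auto simp: e)
qed

section \<open>Gaussians and their Fourier transforms\<close>

lemma gaussian_integrable:
  assumes "e > 0"
  shows "integrable lborel (\<lambda>y::real. exp (- (e * y)\<^sup>2 / 2))"
proof -
  have "integrable lborel (\<lambda>y. sqrt (2 * pi) * normal_density 0 1 (0 + e * y))"
    using assms by (intro integrable_mult_right lborel_integrable_real_affine) auto
  then show ?thesis
    by (simp add: normal_density_def real_sqrt_mult)
qed

text \<open>A rescaling of the characteristic function of the standard normal law. The right-hand
  side is expressed through a density so that its total mass, 2 pi, visibly does not depend on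
  \<open>e\<close>.\<close>

lemma gaussian_fourier:
  fixes z e :: real
  assumes e: "e > 0"
  shows "(\<integral>y. iexp (- (z * y)) * exp (- (e * y)\<^sup>2 / 2) \<partial>lborel)
    = complex_of_real (2 * pi * normal_density 0 e z)"
proof -
  have "exp (- (z / e)\<^sup>2 / 2) = char std_normal_distribution (- z / e)"
    by (simp add: char_std_normal_distribution exp_of_real power_divide)
  also have "\<dots> = (\<integral>x. std_normal_density x *\<^sub>R iexp (- z / e * x) \<partial>lborel)"
    unfolding char_def by (subst integral_density) auto
  also have "\<dots> = \<bar>e\<bar> *\<^sub>R (\<integral>y. std_normal_density (0 + e * y) *\<^sub>R iexp (- z / e * (0 + e * y)) \<partial>lborel)"
    using e by (intro lborel_integral_real_affine) auto
  also have "\<dots> = (e / sqrt (2 * pi)) *\<^sub>R (\<integral>y. iexp (- (z * y)) * exp (- (e * y)\<^sup>2 / 2) \<partial>lborel)"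
    using e unfolding scaleR_scaleR[symmetric] integral_scaleR_right[symmetric]
    by (auto intro!: Bochner_Integration.integral_cong
        simp: normal_density_def scaleR_conv_of_real real_sqrt_mult mult_ac)
  finally have "(\<integral>y. iexp (- (z * y)) * exp (- (e * y)\<^sup>2 / 2) \<partial>lborel)
      = (sqrt (2 * pi) / e) *\<^sub>R complex_of_real (exp (- (z / e)\<^sup>2 / 2))"
    using e by simp
  moreover have "sqrt (2 * pi) / e * exp (- (z / e)\<^sup>2 / 2) = 2 * pi * normal_density 0 e z"
    using e by (simp add: normal_density_def real_sqrt_mult power_divide field_simps)
  ultimately show ?thesis
    by (simp only: scaleR_conv_of_real flip: of_real_mult)
qed


lemma exp_norm_eq_prod:
  fixes x :: "'a::euclidean_space"
  shows "exp (- (e * norm x)\<^sup>2 / 2) = (\<Prod>b\<in>Basis. exp (- (e * (x \<bullet> b))\<^sup>2 / 2))"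
proof -
  have "(norm x)\<^sup>2 = (\<Sum>b\<in>Basis. (x \<bullet> b)\<^sup>2)"
    by (subst power2_norm_eq_inner, subst euclidean_inner) (simp add: power2_eq_square)
  then have "- (e * norm x)\<^sup>2 / 2 = (\<Sum>b\<in>Basis. - (e * (x \<bullet> b))\<^sup>2 / 2)"
    by (simp add: power_mult_distrib sum_distrib_left sum_negf sum_divide_distrib)
  then show ?thesis
    by (simp add: exp_sum)
qed

text \<open>This is the Fourier transform of the weight exp (- (e |x|)^2 / 2): (2 pi)^n times the
  density of a centred normal law with independent coordinates of standard deviation
  \<open>e\<close>.\<close>

definition gauss_kernel :: "real \<Rightarrow> 'a::euclidean_space \<Rightarrow> real" where
  "gauss_kernel e z = (\<Prod>b\<in>Basis. 2 * pi * normal_density 0 e (z \<bullet> b))"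

lemma gauss_kernel_nonneg: "0 \<le> gauss_kernel e z"
  by (auto simp: gauss_kernel_def intro!: prod_nonneg)

lemma gauss_kernel_measurable[measurable]: "gauss_kernel e \<in> borel_measurable borel"
  unfolding gauss_kernel_def[abs_def] by measurable

lemma gauss_kernel_minus_commute: "gauss_kernel e (x - y) = gauss_kernel e (y - x)"
  by (auto simp: gauss_kernel_def normal_density_def inner_diff_left power2_commute intro!: prod.cong)

lemma nn_integral_gauss_kernel:
  assumes "e > 0"
  shows "(\<integral>\<^sup>+z. ennreal (gauss_kernel e (z::'a::euclidean_space)) \<partial>lborel) = ennreal ((2 * pi) ^ DIM('a))"
proof -
  have "(\<integral>\<^sup>+y. ennreal (2 * pi * normal_density 0 e y) \<partial>lborel) = ennreal (2 * pi)"
    using assms by (subst nn_integral_eq_integral) auto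
  then have "(\<Prod>b\<in>(Basis::'a set). \<integral>\<^sup>+y. ennreal (2 * pi * normal_density 0 e y) \<partial>lborel)
      = ennreal ((2 * pi) ^ DIM('a))"
    by (simp add: ennreal_power)
  then show ?thesis
    using nn_integral_lborel_prod[where 'a='a and f="\<lambda>b y. ennreal (2 * pi * normal_density 0 e y)"]
    by (simp add: gauss_kernel_def prod_ennreal)
qed

lemma gaussian_weight_integrable:
  assumes "e > 0"
  shows "integrable lborel (\<lambda>x::'a::euclidean_space. exp (- (e * norm x)\<^sup>2 / 2))"
proof -
  have "integrable lborel (\<lambda>x::'a. \<Prod>b\<in>Basis. complex_of_real (exp (- (e * (x \<bullet> b))\<^sup>2 / 2)))"
    using gaussian_integrable[OF assms]
    by (intro integrable_lborel_prod integrable_of_real) auto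
  then have "integrable lborel (\<lambda>x::'a. complex_of_real (exp (- (e * norm x)\<^sup>2 / 2)))"
    by (simp only: exp_norm_eq_prod of_real_prod)
  then show ?thesis
    unfolding complex_of_real_integrable_eq .
qed

lemma gaussian_weight_fourier:
  fixes z :: "'a::euclidean_space"
  assumes e: "e > 0"
  shows "(\<integral>x. iexp (- (z \<bullet> x)) * exp (- (e * norm x)\<^sup>2 / 2) \<partial>lborel)
    = complex_of_real (gauss_kernel e z)"
proof -
  have int: "integrable lborel (\<lambda>y. iexp (- ((z \<bullet> b) * y)) * complex_of_real (exp (- (e * y)\<^sup>2 / 2)))" for b
  proof (rule Bochner_Integration.integrable_bound)
    show "integrable lborel (\<lambda>y. complex_of_real (exp (- (e * y)\<^sup>2 / 2)))"
      by (intro integrable_of_real gaussian_integrable e)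
  qed (auto simp: norm_mult)
  have "iexp (- (z \<bullet> x)) * exp (- (e * norm x)\<^sup>2 / 2)
      = (\<Prod>b\<in>Basis. iexp (- ((z \<bullet> b) * (x \<bullet> b))) * complex_of_real (exp (- (e * (x \<bullet> b))\<^sup>2 / 2)))" for x
    unfolding exp_norm_eq_prod euclidean_inner[of z x]
    by (simp add: prod.distrib exp_sum sum_negf[symmetric] sum_distrib_left of_real_sum of_real_prod del: of_real_exp)
  then show ?thesis
    by (simp only: integral_lborel_prod[OF int] gaussian_fourier[OF e] gauss_kernel_def of_real_prod)
qed

lemma nn_integral_lborel_translate:
  fixes c :: "'a::euclidean_space"
  assumes [measurable]: "f \<in> borel_measurable borel"
  shows "(\<integral>\<^sup>+x. f (x - c) \<partial>lborel) = (\<integral>\<^sup>+x. f x \<partial>lborel)"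
proof -
  have "(\<integral>\<^sup>+x. f x \<partial>lborel) = (\<integral>\<^sup>+x. f x \<partial>distr lborel borel ((+) (- c)))"
    by (simp add: lborel_distr_plus)
  also have "\<dots> = (\<integral>\<^sup>+x. f (x - c) \<partial>lborel)"
    by (subst nn_integral_distr) auto
  finally show ?thesis ..
qed

text \<open>Schur's test with a constant test function: g x * g y is at most half the sum of the
  squares, and integrating the kernel in the other variable gives (2 pi)^n. Tonelli and the symmetry
  of the kernel make the two halves equal.\<close>

lemma nn_integral_schur:
  fixes g :: "'a::euclidean_space \<Rightarrow> real"
  assumes [measurable]: "g \<in> borel_measurable borel" and g: "\<And>x. 0 \<le> g x" and e: "e > 0"
  shows "(\<integral>\<^sup>+x. \<integral>\<^sup>+y. ennreal (g x * g y * gauss_kernel e (x - y)) \<partial>lborel \<partial>lborel)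
    \<le> ennreal ((2 * pi) ^ DIM('a)) * (\<integral>\<^sup>+x. ennreal ((g x)\<^sup>2) \<partial>lborel)"
proof -
  let ?K = "\<lambda>x y::'a. ennreal (gauss_kernel e (x - y))"
  let ?c = "ennreal ((2 * pi) ^ DIM('a))"
  have K: "(\<integral>\<^sup>+y. ?K x y \<partial>lborel) = ?c" for x
    using nn_integral_lborel_translate[of "\<lambda>z. ennreal (gauss_kernel e z)" x]
    by (simp add: gauss_kernel_minus_commute[of e x] nn_integral_gauss_kernel[OF e])
  have 1: "(\<integral>\<^sup>+x. \<integral>\<^sup>+y. ennreal ((g x)\<^sup>2 / 2) * ?K x y \<partial>lborel \<partial>lborel)
      = (\<integral>\<^sup>+x. ennreal ((g x)\<^sup>2 / 2) \<partial>lborel) * ?c"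
    by (simp add: nn_integral_cmult nn_integral_multc K)
  have "(\<integral>\<^sup>+x. \<integral>\<^sup>+y. ennreal ((g y)\<^sup>2 / 2) * ?K x y \<partial>lborel \<partial>lborel)
      = (\<integral>\<^sup>+y. \<integral>\<^sup>+x. ennreal ((g y)\<^sup>2 / 2) * ?K x y \<partial>lborel \<partial>lborel)"
    by (rule lborel_pair.Fubini') measurable
  also have "\<dots> = (\<integral>\<^sup>+x. ennreal ((g x)\<^sup>2 / 2) \<partial>lborel) * ?c"
    using 1 by (simp add: gauss_kernel_minus_commute[of e])
  finally have 2: "(\<integral>\<^sup>+x. \<integral>\<^sup>+y. ennreal ((g y)\<^sup>2 / 2) * ?K x y \<partial>lborel \<partial>lborel)
      = (\<integral>\<^sup>+x. ennreal ((g x)\<^sup>2 / 2) \<partial>lborel) * ?c" .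
  have "(\<integral>\<^sup>+x. \<integral>\<^sup>+y. ennreal (g x * g y * gauss_kernel e (x - y)) \<partial>lborel \<partial>lborel)
      \<le> (\<integral>\<^sup>+x. \<integral>\<^sup>+y. ennreal ((g x)\<^sup>2 / 2) * ?K x y + ennreal ((g y)\<^sup>2 / 2) * ?K x y \<partial>lborel \<partial>lborel)"
  proof (intro nn_integral_mono)
    fix x y
    have "0 \<le> (g x - g y)\<^sup>2"
      by simp
    then have "g x * g y \<le> (g x)\<^sup>2 / 2 + (g y)\<^sup>2 / 2"
      by (simp add: power2_diff)
    then have "g x * g y * gauss_kernel e (x - y) \<le> ((g x)\<^sup>2 / 2 + (g y)\<^sup>2 / 2) * gauss_kernel e (x - y)"
      by (intro mult_right_mono gauss_kernel_nonneg)
    then show "ennreal (g x * g y * gauss_kernel e (x - y))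
        \<le> ennreal ((g x)\<^sup>2 / 2) * ?K x y + ennreal ((g y)\<^sup>2 / 2) * ?K x y"
      by (simp add: gauss_kernel_nonneg distrib_right flip: ennreal_mult' ennreal_plus)
  qed
  also have "\<dots> = (\<integral>\<^sup>+x. ennreal ((g x)\<^sup>2 / 2) \<partial>lborel) * ?c + (\<integral>\<^sup>+x. ennreal ((g x)\<^sup>2 / 2) \<partial>lborel) * ?c"
    by (simp add: nn_integral_add 1 2)
  also have "\<dots> = ?c * (\<integral>\<^sup>+x. ennreal ((g x)\<^sup>2 / 2) + ennreal ((g x)\<^sup>2 / 2) \<partial>lborel)"
    by (simp add: nn_integral_add algebra_simps)
  also have "\<dots> = ?c * (\<integral>\<^sup>+x. ennreal ((g x)\<^sup>2) \<partial>lborel)"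
    by (simp flip: ennreal_plus)
  finally show ?thesis .
qed

section \<open>Fourier transforms of integrable Borel functions\<close>

lemma borel_measurable_cnj[measurable (raw)]:
  "f \<in> borel_measurable M \<Longrightarrow> (\<lambda>x. cnj (f x)) \<in> borel_measurable M"
  by (rule borel_measurable_continuous_on[where g=f]) (auto intro!: continuous_intros)

lemma fourier_lborel:
  assumes [measurable]: "f \<in> borel_measurable borel"
  shows "fourier f \<xi> = (\<integral>x. iexp (- (x \<bullet> \<xi>)) * f x \<partial>lborel)"
  unfolding fourier_def by (subst integral_completion) auto

lemma fourier_borel_measurable:
  assumes [measurable]: "f \<in> borel_measurable borel"
  shows "fourier f \<in> borel_measurable borel"
proof -
  have "(\<lambda>\<xi>. \<integral>x. iexp (- (x \<bullet> \<xi>)) * f x \<partial>lborel) \<in> borel_measurable borel"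
    by measurable
  then show ?thesis
    by (simp add: fourier_lborel[OF assms, abs_def])
qed

lemma norm_fourier_le:
  assumes [measurable]: "f \<in> borel_measurable borel" 
  shows "cmod (fourier f \<xi>) \<le> (\<integral>x. cmod (f x) \<partial>lborel)"
  unfolding fourier_lborel[OF assms]
  by (rule order.trans[OF integral_norm_bound]) (simp add: norm_mult)

text \<open>The Gaussian makes the triple integral in x, y and \<xi> absolutely convergent.
  Integrating in \<xi> first turns it into a quadratic form with kernel \<open>gauss_kernel\<close>,
  to which Schur's test applies.\<close>

lemma fourier_gaussian_bound:
  fixes f :: "'a::euclidean_space \<Rightarrow> complex"
  assumes f: "integrable lborel f" and e: "e > 0"
  shows "(\<integral>\<^sup>+\<xi>. ennreal ((cmod (fourier f \<xi>))\<^sup>2 * exp (- (e * norm \<xi>)\<^sup>2 / 2)) \<partial>lborel)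
    \<le> ennreal ((2 * pi) ^ DIM('a)) * (\<integral>\<^sup>+x. ennreal ((cmod (f x))\<^sup>2) \<partial>lborel)"
proof -
  let ?G = "\<lambda>\<xi>::'a. exp (- (e * norm \<xi>)\<^sup>2 / 2)"
  let ?E = "\<lambda>x \<xi>::'a. iexp (- (x \<bullet> \<xi>))"
  have fm[measurable]: "f \<in> borel_measurable borel"
    using f by auto
  note fourier_borel_measurable[OF fm, measurable]
  define M where "M = (\<integral>x. cmod (f x) \<partial>lborel)"
  have M: "cmod (fourier f \<xi>) \<le> M" for \<xi>
    unfolding M_def by (rule norm_fourier_le) measurable
  have M0: "0 \<le> M"
    unfolding M_def by simp
  have G: "integrable lborel ?G"
    by (rule gaussian_weight_integrable[OF e])
  have pairint: "integrable (lborel \<Otimes>\<^sub>M lborel) (\<lambda>(\<xi>, x). ?G \<xi> * norm (f x))"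
    by (rule lborel_pair.Fubini_integrable) (use f G in auto)
  have GM: "integrable lborel (\<lambda>\<xi>. M * ?G \<xi>)" "integrable lborel (\<lambda>\<xi>. M\<^sup>2 * ?G \<xi>)"
    using G by auto
  \<comment> \<open>The square of the modulus is written as a product with the conjugate, which
    allows Fubini; \<open>I\<close> is nevertheless a nonnegative real, so \<open>cmod I\<close>
    recovers the integral to be bounded.\<close>
  define I where "I = (\<integral>\<xi>. fourier f \<xi> * cnj (fourier f \<xi>) * ?G \<xi> \<partial>lborel)"
  have FG: "integrable lborel (\<lambda>\<xi>. (cmod (fourier f \<xi>))\<^sup>2 * ?G \<xi>)"
    by (rule Bochner_Integration.integrable_bound[OF GM(2)])
       (auto simp: abs_mult intro!: AE_I2 mult_right_mono power_mono M)
  have I_eq: "I = complex_of_real (\<integral>\<xi>. (cmod (fourier f \<xi>))\<^sup>2 * ?G \<xi> \<partial>lborel)"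
    unfolding I_def integral_complex_of_real[symmetric]
    by (intro Bochner_Integration.integral_cong) (auto simp: complex_norm_square simp del: of_real_power)
  have "(\<integral>\<^sup>+\<xi>. ennreal ((cmod (fourier f \<xi>))\<^sup>2 * ?G \<xi>) \<partial>lborel) = ennreal (cmod I)"
    unfolding I_eq using FG by (subst nn_integral_eq_integral) auto
  define J where "J = (\<lambda>x. \<integral>\<xi>. ?E x \<xi> * cnj (fourier f \<xi>) * ?G \<xi> \<partial>lborel)"
  have J_eq: "J x = (\<integral>y. cnj (f y) * gauss_kernel e (x - y) \<partial>lborel)" for x
  proof -
    have "J x = (\<integral>\<xi>. \<integral>y. ?E x \<xi> * cnj (?E y \<xi> * f y) * ?G \<xi> \<partial>lborel \<partial>lborel)"
      by (simp only: J_def fourier_lborel[OF fm] Bochner_Integration.integral_cnj integral_mult_right_zero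
          integral_mult_left_zero)
    \<comment> \<open>Phases have modulus one, so the integrand is dominated by the function in
      \<open>pairint\<close>.\<close>
    also have "\<dots> = (\<integral>y. \<integral>\<xi>. ?E x \<xi> * cnj (?E y \<xi> * f y) * ?G \<xi> \<partial>lborel \<partial>lborel)"
    proof (rule lborel_pair.Fubini_integral[symmetric],
        rule Bochner_Integration.integrable_bound[OF pairint])
      show "AE z in lborel \<Otimes>\<^sub>M lborel.
          norm (case z of (\<xi>, y) \<Rightarrow> ?E x \<xi> * cnj (?E y \<xi> * f y) * ?G \<xi>)
            \<le> norm (case z of (\<xi>, y) \<Rightarrow> ?G \<xi> * norm (f y))"
        by (intro AE_I2) (auto simp: norm_mult)
    qed measurable
    also have "\<dots> = (\<integral>y. cnj (f y) * (\<integral>\<xi>. ?E (x - y) \<xi> * ?G \<xi> \<partial>lborel) \<partial>lborel)"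
    proof -
      have "?E x \<xi> * cnj (?E y \<xi>) = ?E (x - y) \<xi>" for y \<xi>
        by (simp add: exp_cnj inner_diff_left algebra_simps flip: exp_add)
      then have "?E x \<xi> * cnj (?E y \<xi> * f y) * ?G \<xi> = cnj (f y) * (?E (x - y) \<xi> * ?G \<xi>)" for y \<xi>
        by (simp add: mult_ac)
      then show ?thesis
        by (simp only: integral_mult_right_zero)
    qed
    finally show ?thesis
      by (simp only: gaussian_weight_fourier[OF e])
  qed
  \<comment> \<open>Only one of the two transforms is opened here; the other stays closed and is
    bounded by \<open>M\<close>, which gives the majorant for Fubini. It is opened inside
    \<open>J\<close>.\<close>
  have "I = (\<integral>\<xi>. \<integral>x. ?E x \<xi> * f x * (cnj (fourier f \<xi>) * ?G \<xi>) \<partial>lborel \<partial>lborel)"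
    unfolding I_def integral_mult_left_zero fourier_lborel[OF fm, symmetric]
    by (simp only: mult.assoc)
  also have "\<dots> = (\<integral>x. \<integral>\<xi>. ?E x \<xi> * f x * (cnj (fourier f \<xi>) * ?G \<xi>) \<partial>lborel \<partial>lborel)"
  proof (rule lborel_pair.Fubini_integral[symmetric], 
      rule Bochner_Integration.integrable_bound[OF integrable_mult_right[OF pairint, of M]])
    show "AE z in lborel \<Otimes>\<^sub>M lborel. 
       norm (case z of (\<xi>, x) \<Rightarrow> ?E x \<xi> * f x * (cnj (fourier f \<xi>) * ?G \<xi>))
         \<le> norm (M * (case z of (\<xi>, x) \<Rightarrow> ?G \<xi> * norm (f x)))"
    proof (rule AE_I2)
      fix z :: "'a \<times> 'a"
      have "cmod (fourier f (fst z)) * (?G (fst z) * cmod (f (snd z))) \<le> M * (?G (fst z) * cmod (f (snd z)))"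
        by (intro mult_right_mono M) auto
      then show "norm (case z of (\<xi>, x) \<Rightarrow> ?E x \<xi> * f x * (cnj (fourier f \<xi>) * ?G \<xi>))
         \<le> norm (M * (case z of (\<xi>, x) \<Rightarrow> ?G \<xi> * norm (f x)))"
        using M0 by (simp add: norm_mult abs_mult split_beta' mult_ac)
    qed
  qed measurable
  also have "\<dots> = (\<integral>x. f x * J x \<partial>lborel)"
    unfolding J_def by (simp add: mult_ac flip: integral_mult_right_zero)
  finally have I2: "I = (\<integral>x. f x * J x \<partial>lborel)" .
  have Jm[measurable]: "J \<in> borel_measurable borel"
    unfolding J_def[abs_def] by measurable
  \<comment> \<open>For a non-integrable \<open>h\<close> the Bochner integral is 0 by convention,
    so the bound holds for every \<open>h\<close>.\<close>
  have nb: "ennreal (cmod (integral\<^sup>L lborel h)) \<le> (\<integral>\<^sup>+x. ennreal (cmod (h x)) \<partial>lborel)"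
    for h :: "'a \<Rightarrow> complex"
    by (cases "integrable lborel h") (auto simp: not_integrable_integral_eq intro: integral_norm_bound_ennreal)
  have "ennreal (cmod I) \<le> (\<integral>\<^sup>+x. ennreal (cmod (f x * J x)) \<partial>lborel)"
    unfolding I2 by (rule nb)
  also have "\<dots> \<le> (\<integral>\<^sup>+x. \<integral>\<^sup>+y. ennreal (cmod (f x) * cmod (f y) * gauss_kernel e (x - y)) \<partial>lborel \<partial>lborel)"
  proof (rule nn_integral_mono)
    fix x
    have "ennreal (cmod (f x * J x)) = ennreal (cmod (f x)) * ennreal (cmod (J x))"
      by (simp add: norm_mult ennreal_mult)
    also have "\<dots> \<le> ennreal (cmod (f x)) * (\<integral>\<^sup>+y. ennreal (cmod (cnj (f y) * gauss_kernel e (x - y))) \<partial>lborel)"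
      unfolding J_eq by (intro mult_left_mono nb) auto
    also have "\<dots> = (\<integral>\<^sup>+y. ennreal (cmod (f x) * cmod (f y) * gauss_kernel e (x - y)) \<partial>lborel)"
      by (subst nn_integral_cmult[symmetric])
         (auto simp: norm_mult gauss_kernel_nonneg mult.assoc ennreal_mult'[symmetric] intro!: nn_integral_cong)
    finally show "ennreal (cmod (f x * J x)) \<le> \<dots>" .
  qed
  also have "\<dots> \<le> ennreal ((2 * pi) ^ DIM('a)) * (\<integral>\<^sup>+x. ennreal ((cmod (f x))\<^sup>2) \<partial>lborel)"
    by (rule nn_integral_schur) (auto simp: e)
  finally show ?thesis
    using \<open>(\<integral>\<^sup>+\<xi>. ennreal ((cmod (fourier f \<xi>))\<^sup>2 * ?G \<xi>) \<partial>lborel) = ennreal (cmod I)\<close> by simp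
qed

text \<open>The Gaussian bound is uniform in \<open>e\<close>, so Fatou's lemma along e = 1 / (k +
  1) removes the weight.\<close>

lemma fourier_plancherel_le_lborel:
  fixes f :: "'a::euclidean_space \<Rightarrow> complex"
  assumes f: "integrable lborel f"
  shows "(\<integral>\<^sup>+\<xi>. ennreal ((cmod (fourier f \<xi>))\<^sup>2) \<partial>lborel)
    \<le> ennreal ((2 * pi) ^ DIM('a)) * (\<integral>\<^sup>+x. ennreal ((cmod (f x))\<^sup>2) \<partial>lborel)"
proof -
  have fm[measurable]: "f \<in> borel_measurable borel"
    using f by auto
  note fourier_borel_measurable[OF fm, measurable]
  let ?g = "\<lambda>k \<xi>. (cmod (fourier f \<xi>))\<^sup>2 * exp (- (inverse (real (Suc k)) * norm \<xi>)\<^sup>2 / 2)"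
  \<comment> \<open>At width parameter 0 the weight equals 1.\<close>
  have lim: "(\<lambda>k. ?g k \<xi>) \<longlonglongrightarrow> (cmod (fourier f \<xi>))\<^sup>2 * exp (- (0 * norm \<xi>)\<^sup>2 / 2)" for \<xi>
    by (intro tendsto_intros LIMSEQ_inverse_real_of_nat) auto
  have "(\<integral>\<^sup>+\<xi>. ennreal ((cmod (fourier f \<xi>))\<^sup>2) \<partial>lborel) = (\<integral>\<^sup>+\<xi>. liminf (\<lambda>k. ennreal (?g k \<xi>)) \<partial>lborel)"
    using lim by (intro nn_integral_cong lim_imp_Liminf[symmetric]) auto
  also have "\<dots> \<le> liminf (\<lambda>k. \<integral>\<^sup>+\<xi>. ennreal (?g k \<xi>) \<partial>lborel)"
    by (rule nn_integral_liminf) measurable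
  also have "\<dots> \<le> liminf (\<lambda>k::nat. ennreal ((2 * pi) ^ DIM('a)) * (\<integral>\<^sup>+x. ennreal ((cmod (f x))\<^sup>2) \<partial>lborel))"
    by (intro Liminf_mono always_eventually allI fourier_gaussian_bound f) simp
  finally show ?thesis
    by (simp add: Liminf_const)
qed

section \<open>The Fourier transform on square integrable functions\<close>

text \<open>
  Along a subsequence with \<open>\<parallel>d\<^sub>k\<parallel>\<^sup>2 \<le> 4\<^sup>-\<^sup>k\<close> for the increments, the weighted sum of
  \<open>2\<^sup>k |d\<^sub>k|\<^sup>2\<close> is integrable, hence finite almost everywhere, and
  \<open>2 |d\<^sub>k| \<le> 2\<^sup>-\<^sup>k + 2\<^sup>k |d\<^sub>k|\<^sup>2\<close>. This avoids Minkowski's inequality.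
\<close>

lemma L2_complete:
  fixes F :: "nat \<Rightarrow> 'a \<Rightarrow> 'b::{banach, second_countable_topology}"
  assumes F[measurable]: "\<And>n. F n \<in> borel_measurable M"
    and cauchy: "\<And>e::real. e > 0 \<Longrightarrow>
      \<exists>N. \<forall>m\<ge>N. \<forall>n\<ge>N. (\<integral>\<^sup>+x. ennreal ((norm (F m x - F n x))\<^sup>2) \<partial>M) \<le> ennreal e"
  shows "\<exists>g\<in>borel_measurable M. (\<lambda>n. \<integral>\<^sup>+x. ennreal ((norm (F n x - g x))\<^sup>2) \<partial>M) \<longlonglongrightarrow> 0"
proof -
  have "\<forall>k. \<exists>N. \<forall>m\<ge>N. \<forall>n\<ge>N. (\<integral>\<^sup>+x. ennreal ((norm (F m x - F n x))\<^sup>2) \<partial>M) \<le> ennreal ((1 / 4) ^ k)"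
    by (intro allI cauchy) simp
  then obtain N where N: "\<And>k m n. m \<ge> N k \<Longrightarrow> n \<ge> N k \<Longrightarrow>
      (\<integral>\<^sup>+x. ennreal ((norm (F m x - F n x))\<^sup>2) \<partial>M) \<le> ennreal ((1 / 4) ^ k)"
    by metis
  \<comment> \<open>Summing the indices puts \<open>r k\<close> beyond every \<open>N j\<close> with
    j \<le> k simultaneously.\<close>
  define r where "r = (\<lambda>k. \<Sum>i\<le>k. N i)"
  have r: "N j \<le> r k" if "j \<le> k" for j k
    unfolding r_def using that by (intro member_le_sum) auto
  define d where "d = (\<lambda>k x. F (r (Suc k)) x - F (r k) x)"
  have dm[measurable]: "d k \<in> borel_measurable M" for k
    unfolding d_def by measurable
  have dk: "(\<integral>\<^sup>+x. ennreal ((norm (d k x))\<^sup>2) \<partial>M) \<le> ennreal ((1 / 4) ^ k)" for k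
    unfolding d_def by (intro N r) auto
  have "(\<integral>\<^sup>+x. (\<Sum>k. ennreal (2 ^ k * (norm (d k x))\<^sup>2)) \<partial>M)
      = (\<Sum>k. \<integral>\<^sup>+x. ennreal (2 ^ k * (norm (d k x))\<^sup>2) \<partial>M)"
    by (rule nn_integral_suminf) measurable
  also have "\<dots> \<le> (\<Sum>k. ennreal ((1 / 2) ^ k))"
  proof (intro suminf_le allI)
    fix k
    have "(\<integral>\<^sup>+x. ennreal (2 ^ k * (norm (d k x))\<^sup>2) \<partial>M) = ennreal (2 ^ k) * (\<integral>\<^sup>+x. ennreal ((norm (d k x))\<^sup>2) \<partial>M)"
      by (simp add: ennreal_mult nn_integral_cmult)
    also have "\<dots> \<le> ennreal (2 ^ k) * ennreal ((1 / 4) ^ k)"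
      by (intro mult_left_mono dk) auto
    also have "\<dots> = ennreal ((1 / 2) ^ k)"
      by (simp flip: ennreal_mult power_mult_distrib)
    finally show "(\<integral>\<^sup>+x. ennreal (2 ^ k * (norm (d k x))\<^sup>2) \<partial>M) \<le> ennreal ((1 / 2) ^ k)" .
  qed auto
  also have "\<dots> < \<infinity>"
    by (subst suminf_ennreal2) (auto intro!: summable_geometric)
  finally have "AE x in M. (\<Sum>k. ennreal (2 ^ k * (norm (d k x))\<^sup>2)) \<noteq> \<infinity>"
    by (intro nn_integral_PInf_AE) auto
  then have conv: "AE x in M. convergent (\<lambda>k. F (r k) x)"
  proof eventually_elim
    fix x
    assume "(\<Sum>k. ennreal (2 ^ k * (norm (d k x))\<^sup>2)) \<noteq> \<infinity>"
    then have s: "summable (\<lambda>k. 2 ^ k * (norm (d k x))\<^sup>2)"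
      by (intro summable_suminf_not_top) (auto simp: infinity_ennreal_def)
    have "summable (\<lambda>k. d k x)"
    proof (rule summable_comparison_test')
      show "summable (\<lambda>k. ((1 / 2) ^ k + 2 ^ k * (norm (d k x))\<^sup>2) / 2)"
        by (intro summable_divide summable_add s summable_geometric) auto
      fix k
      have "0 \<le> 2 ^ k * (norm (d k x) - (1 / 2) ^ k)\<^sup>2"
        by simp
      also have "\<dots> = 2 ^ k * (norm (d k x))\<^sup>2 - 2 * norm (d k x) + (1 / 2) ^ k"
        by (simp add: power2_diff algebra_simps power_one_over power2_eq_square)
      finally show "norm (d k x) \<le> ((1 / 2) ^ k + 2 ^ k * (norm (d k x))\<^sup>2) / 2"
        by simp
    qed
    then have "convergent (\<lambda>k. \<Sum>i<k. d i x)"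
      by (simp add: summable_iff_convergent)
    then have "convergent (\<lambda>k. F (r 0) x + (\<Sum>i<k. d i x))"
      by (intro convergent_add convergent_const)
    moreover have "F (r 0) x + (\<Sum>i<k. d i x) = F (r k) x" for k
      unfolding d_def by (subst sum_lessThan_telescope) simp
    ultimately show "convergent (\<lambda>k. F (r k) x)"
      by simp
  qed
  \<comment> \<open>Where the subsequence diverges \<open>lim\<close> is an unspecified value, but
    this happens only on a null set.\<close>
  define g where "g = (\<lambda>x. lim (\<lambda>k. F (r k) x))"
  have g[measurable]: "g \<in> borel_measurable M"
    unfolding g_def by (intro borel_measurable_lim_metric) auto
  \<comment> \<open>Fatou along the subsequence, with \<open>n\<close> fixed, controls every late
    member of the original sequence, so the whole sequence converges.\<close>
  have bound: "(\<integral>\<^sup>+x. ennreal ((norm (F n x - g x))\<^sup>2) \<partial>M) \<le> ennreal ((1 / 4) ^ j)" if n: "n \<ge> N j" for n j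
  proof -
    have "(\<integral>\<^sup>+x. ennreal ((norm (F n x - g x))\<^sup>2) \<partial>M)
        = (\<integral>\<^sup>+x. liminf (\<lambda>k. ennreal ((norm (F n x - F (r k) x))\<^sup>2)) \<partial>M)"
    proof (rule nn_integral_cong_AE)
      show "AE x in M. ennreal ((norm (F n x - g x))\<^sup>2) = liminf (\<lambda>k. ennreal ((norm (F n x - F (r k) x))\<^sup>2))"
        using conv
      proof eventually_elim
        case (elim x)
        then have "(\<lambda>k. F (r k) x) \<longlonglongrightarrow> g x"
          by (simp add: g_def convergent_LIMSEQ_iff)
        then have "(\<lambda>k. ennreal ((norm (F n x - F (r k) x))\<^sup>2)) \<longlonglongrightarrow> ennreal ((norm (F n x - g x))\<^sup>2)"
          by (intro tendsto_intros)
        then show ?case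
          by (intro lim_imp_Liminf[symmetric]) auto
      qed
    qed
    also have "\<dots> \<le> liminf (\<lambda>k. \<integral>\<^sup>+x. ennreal ((norm (F n x - F (r k) x))\<^sup>2) \<partial>M)"
      by (rule nn_integral_liminf) measurable
    also have "\<dots> \<le> liminf (\<lambda>k::nat. ennreal ((1 / 4) ^ j))"
    proof (rule Liminf_mono)
      show "eventually (\<lambda>k. (\<integral>\<^sup>+x. ennreal ((norm (F n x - F (r k) x))\<^sup>2) \<partial>M) \<le> ennreal ((1 / 4) ^ j)) sequentially"
        using eventually_ge_at_top[of j] by eventually_elim (intro N n r)
    qed
    finally show ?thesis
      by (simp add: Liminf_const)
  qed
  have "(\<lambda>n. \<integral>\<^sup>+x. ennreal ((norm (F n x - g x))\<^sup>2) \<partial>M) \<longlonglongrightarrow> 0"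
  proof (rule order_tendstoI)
    fix a :: ennreal
    assume "0 < a"
    have "(\<lambda>j. ennreal ((1 / 4) ^ j)) \<longlonglongrightarrow> ennreal 0"
      by (intro tendsto_intros LIMSEQ_realpow_zero) auto
    then have "eventually (\<lambda>j. ennreal ((1 / 4) ^ j) < a) sequentially"
      using \<open>0 < a\<close> by (simp add: order_tendsto_iff)
    then obtain j where "ennreal ((1 / 4) ^ j) < a"
      by (auto dest: eventually_happens)
    then show "eventually (\<lambda>n. (\<integral>\<^sup>+x. ennreal ((norm (F n x - g x))\<^sup>2) \<partial>M) < a) sequentially"
      using bound by (intro eventually_sequentiallyI[of "N j"]) (rule le_less_trans)
  qed simp
  then show ?thesis
    using g by blast
qed

section \<open>Square roots and squared norms in the extended reals\<close>

lemma ennreal_sqrt_ennreal: "0 \<le> x \<Longrightarrow> ennreal_sqrt (ennreal x) = ennreal (sqrt x)"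
  by (simp add: ennreal_sqrt_def)

lemma ennreal_sqrt_power2: "(ennreal_sqrt a)\<^sup>2 = a"
  by (cases a) (auto simp: ennreal_sqrt_ennreal ennreal_power, simp add: ennreal_sqrt_def)

lemma ennreal_sqrt_eq_top_iff: "ennreal_sqrt a = \<infinity> \<longleftrightarrow> a = \<infinity>"
  by (simp add: ennreal_sqrt_def)

lemma ennreal_sqrt_mono: "a \<le> b \<Longrightarrow> ennreal_sqrt a \<le> ennreal_sqrt b"
  by (cases a; cases b) (auto simp: ennreal_sqrt_ennreal, auto simp: ennreal_sqrt_def top_unique)

lemma tendsto_ennreal_sqrt_0:
  assumes "(f \<longlongrightarrow> 0) F"
  shows "((\<lambda>x. ennreal_sqrt (f x)) \<longlongrightarrow> 0) F"
proof (rule order_tendstoI)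
  fix a :: ennreal
  assume "0 < a"
  \<comment> \<open>\<open>a\<close> may be infinite, so a finite \<open>e\<close> below it is used.
    Halving \<open>e\<close> later turns the weak monotonicity of the root into a strict
    inequality.\<close>
  then obtain e where e: "0 < e" "ennreal e \<le> a"
    by (cases a) (auto intro: that[of 1])
  have "eventually (\<lambda>x. f x < ennreal ((e / 2)\<^sup>2)) F"
    using assms e by (intro order_tendstoD) (auto simp: ennreal_0[symmetric] simp del: ennreal_0 intro!: ennreal_lessI)
  then show "eventually (\<lambda>x. ennreal_sqrt (f x) < a) F"
  proof eventually_elim
    case (elim x)
    then have "ennreal_sqrt (f x) \<le> ennreal_sqrt (ennreal ((e / 2)\<^sup>2))"
      by (intro ennreal_sqrt_mono) auto
    also have "\<dots> = ennreal (e / 2)"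
      using e by (subst ennreal_sqrt_ennreal) auto
    also have "\<dots> < ennreal e"
      using e by (intro ennreal_lessI) auto
    finally show ?case
      using e by simp
  qed
qed simp

text \<open>Estimates are carried out for the squared norm, which is additive over sets; the root is
  taken only at the end.\<close>

definition L2sq :: "('a::euclidean_space \<Rightarrow> complex) \<Rightarrow> ennreal" where
  "L2sq f = (\<integral>\<^sup>+x. ennreal ((cmod (f x))\<^sup>2) \<partial>lebesgue)"

lemma L2norm_eq: "L2norm f = ennreal_sqrt (L2sq f)"
  by (simp add: L2norm_def L2sq_def)

lemma L2norm_power2: "(L2norm f)\<^sup>2 = L2sq f"
  by (simp add: L2norm_eq ennreal_sqrt_power2)

lemma L2_iff: "f \<in> L2 \<longleftrightarrow> f \<in> borel_measurable lebesgue \<and> L2sq f < \<infinity>"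
  using ennreal_sqrt_eq_top_iff[of "L2sq f"] by (auto simp: L2_def L2norm_eq less_top[symmetric])

lemma tendsto_L2norm_0_iff: "((\<lambda>k. L2norm (f k)) \<longlongrightarrow> 0) F \<longleftrightarrow> ((\<lambda>k. L2sq (f k)) \<longlongrightarrow> 0) F"
proof
  assume "((\<lambda>k. L2norm (f k)) \<longlongrightarrow> 0) F"
  then have "((\<lambda>k. L2norm (f k) * L2norm (f k)) \<longlongrightarrow> 0 * 0) F"
    by (intro tendsto_mult_ennreal) auto
  then show "((\<lambda>k. L2sq (f k)) \<longlongrightarrow> 0) F"
    by (simp add: L2norm_power2[symmetric] power2_eq_square)
qed (auto simp: L2norm_eq intro: tendsto_ennreal_sqrt_0)

lemma cmod_add_power2_le: "(cmod (a + b))\<^sup>2 \<le> 2 * (cmod a)\<^sup>2 + 2 * (cmod b)\<^sup>2"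
proof -
  have "(cmod (a + b))\<^sup>2 \<le> (cmod a + cmod b)\<^sup>2"
    by (intro power_mono norm_triangle_ineq) auto
  also have "\<dots> \<le> 2 * (cmod a)\<^sup>2 + 2 * (cmod b)\<^sup>2"
    using zero_le_power2[of "cmod a - cmod b"] by (simp add: power2_diff power2_sum)
  finally show ?thesis .
qed

text \<open>A substitute for the triangle inequality. The factor 2 only affects constants, and the
  bound remains meaningful when an integral is infinite.\<close>

lemma set_L2sq_add_le:
  assumes [measurable]: "f \<in> borel_measurable M" "g \<in> borel_measurable M" "B \<in> sets M"
  shows "(\<integral>\<^sup>+x\<in>B. ennreal ((cmod (f x + g x))\<^sup>2) \<partial>M)
    \<le> 2 * (\<integral>\<^sup>+x\<in>B. ennreal ((cmod (f x))\<^sup>2) \<partial>M) + 2 * (\<integral>\<^sup>+x\<in>B. ennreal ((cmod (g x))\<^sup>2) \<partial>M)"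
proof -
  have "(\<integral>\<^sup>+x\<in>B. ennreal ((cmod (f x + g x))\<^sup>2) \<partial>M)
      \<le> (\<integral>\<^sup>+x. 2 * (ennreal ((cmod (f x))\<^sup>2) * indicator B x) + 2 * (ennreal ((cmod (g x))\<^sup>2) * indicator B x) \<partial>M)"
  proof (rule nn_integral_mono)
    fix x
    have "ennreal ((cmod (f x + g x))\<^sup>2) \<le> ennreal (2 * (cmod (f x))\<^sup>2 + 2 * (cmod (g x))\<^sup>2)"
      by (intro ennreal_leI cmod_add_power2_le)
    then show "ennreal ((cmod (f x + g x))\<^sup>2) * indicator B x
        \<le> 2 * (ennreal ((cmod (f x))\<^sup>2) * indicator B x) + 2 * (ennreal ((cmod (g x))\<^sup>2) * indicator B x)"
      by (auto simp: ennreal_mult split: split_indicator)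
  qed
  also have "\<dots> = 2 * (\<integral>\<^sup>+x\<in>B. ennreal ((cmod (f x))\<^sup>2) \<partial>M) + 2 * (\<integral>\<^sup>+x\<in>B. ennreal ((cmod (g x))\<^sup>2) \<partial>M)"
    by (simp add: nn_integral_add nn_integral_cmult)
  finally show ?thesis .
qed

lemma L2sq_add_le:
  assumes "f \<in> borel_measurable lebesgue" "g \<in> borel_measurable lebesgue"
  shows "L2sq (\<lambda>x. f x + g x) \<le> 2 * L2sq f + 2 * L2sq g"
  using set_L2sq_add_le[OF assms, of UNIV] by (simp add: L2sq_def)

section \<open>Transfer from Borel representatives to Lebesgue measurable functions\<close>

lemma lebesgue_measurable_borel_AE:
  fixes f :: "'a::euclidean_space \<Rightarrow> complex"
  assumes f: "f \<in> borel_measurable lebesgue"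
  obtains g where "g \<in> borel_measurable borel" "AE x in lebesgue. f x = g x"
proof -
  have m: "(\<lambda>x. Re (f x)) \<in> borel_measurable lebesgue" "(\<lambda>x. Im (f x)) \<in> borel_measurable lebesgue"
    using f by measurable
  obtain a where a: "a \<in> borel_measurable borel" "AE x in lborel. Re (f x) = a x"
    using completion_ex_borel_measurable_real[OF m(1)] by auto
  obtain b where b: "b \<in> borel_measurable borel" "AE x in lborel. Im (f x) = b x"
    using completion_ex_borel_measurable_real[OF m(2)] by auto
  have [measurable]: "a \<in> borel_measurable borel" "b \<in> borel_measurable borel"
    by fact+
  have "AE x in lborel. f x = Complex (a x) (b x)"
    using a(2) b(2) by eventually_elim (auto simp: complex_eq_iff)
  then have "AE x in lebesgue. f x = Complex (a x) (b x)"
    by (rule AE_completion)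
  moreover have "(\<lambda>x. Complex (a x) (b x)) \<in> borel_measurable borel"
    unfolding Complex_eq by measurable
  ultimately show ?thesis
    using that by blast
qed

lemma phase_measurable: "(\<lambda>x::'a::euclidean_space. iexp (- (x \<bullet> \<xi>))) \<in> borel_measurable lebesgue"
  by (rule measurable_completion) measurable

lemma fourier_cong_AE:
  assumes "f \<in> borel_measurable lebesgue" "g \<in> borel_measurable lebesgue" "AE x in lebesgue. f x = g x"
  shows "fourier f = fourier g"
proof
  fix \<xi>
  note phase_measurable[measurable]
  have [measurable]: "f \<in> borel_measurable lebesgue" "g \<in> borel_measurable lebesgue"
    by fact+
  have "AE x in lebesgue. exp (- (\<i> * complex_of_real (x \<bullet> \<xi>))) * f x = exp (- (\<i> * complex_of_real (x \<bullet> \<xi>))) * g x"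
    using assms(3) by eventually_elim simp
  moreover have "(\<lambda>x. exp (- (\<i> * complex_of_real (x \<bullet> \<xi>)))) \<in> borel_measurable lebesgue"
    using phase_measurable[of \<xi>] by simp
  ultimately show "fourier f \<xi> = fourier g \<xi>"
    unfolding fourier_def by (intro integral_cong_AE borel_measurable_times) auto
qed

lemma L1_iff: "f \<in> L1 \<longleftrightarrow> integrable lebesgue f"
  by (auto simp: L1_def L1norm_def integrable_iff_bounded)

lemma fourier_measurable:
  assumes f: "f \<in> borel_measurable lebesgue"
  shows "fourier f \<in> borel_measurable lebesgue"
proof -
  obtain g where g: "g \<in> borel_measurable borel" "AE x in lebesgue. f x = g x"
    using lebesgue_measurable_borel_AE[OF f] .
  then have "fourier f = fourier g"
    using f by (intro fourier_cong_AE) (auto intro: measurable_completion)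
  then show ?thesis
    using fourier_borel_measurable[OF g(1)] by (auto intro: measurable_completion)
qed

lemma fourier_plancherel_le:
  fixes f :: "'a::euclidean_space \<Rightarrow> complex"
  assumes f: "f \<in> L1"
  shows "L2sq (fourier f) \<le> ennreal ((2 * pi) ^ DIM('a)) * L2sq f"
proof -
  have fm: "f \<in> borel_measurable lebesgue" and fi: "integrable lebesgue f"
    using f by (auto simp: L1_iff)
  obtain g where g: "g \<in> borel_measurable borel" "AE x in lebesgue. f x = g x"
    using lebesgue_measurable_borel_AE[OF fm] .
  have gm: "g \<in> borel_measurable lebesgue"
    using g(1) by (auto intro: measurable_completion)
  have "integrable lebesgue g"
    using integrable_cong_AE[OF fm gm g(2)] fi by simp
  then have "integrable lborel g"
    using g(1) by (subst (asm) integrable_completion) auto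
  note fourier_plancherel_le_lborel[OF this]
  moreover have "L2sq f = (\<integral>\<^sup>+x. ennreal ((cmod (g x))\<^sup>2) \<partial>lborel)"
    unfolding L2sq_def nn_integral_completion
    using g(2) by (intro nn_integral_cong_AE) (auto simp: AE_completion_iff elim!: eventually_mono)
  moreover have "fourier f = fourier g"
    by (rule fourier_cong_AE[OF fm gm g(2)])
  ultimately show ?thesis
    by (simp add: L2sq_def nn_integral_completion)
qed

lemma phase_mult_integrable:
  assumes "f \<in> L1"
  shows "integrable lebesgue (\<lambda>x. exp (- (\<i> * complex_of_real (x \<bullet> \<xi>))) * f x)"
proof (rule Bochner_Integration.integrable_bound[of lebesgue f])
  show "integrable lebesgue f"
    using assms by (simp add: L1_iff)
  have "(\<lambda>x. exp (- (\<i> * complex_of_real (x \<bullet> \<xi>)))) \<in> borel_measurable lebesgue"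
    using phase_measurable[of \<xi>] by simp
  then show "(\<lambda>x. exp (- (\<i> * complex_of_real (x \<bullet> \<xi>))) * f x) \<in> borel_measurable lebesgue"
    using assms by (intro borel_measurable_times) (auto simp: L1_def)
  show "AE x in lebesgue. norm (exp (- (\<i> * complex_of_real (x \<bullet> \<xi>))) * f x) \<le> norm (f x)"
    by (simp add: norm_mult)
qed

lemma fourier_diff:
  assumes "f \<in> L1" "g \<in> L1"
  shows "fourier f \<xi> - fourier g \<xi> = fourier (\<lambda>x. f x - g x) \<xi>"
  unfolding fourier_def using phase_mult_integrable[OF assms(1)] phase_mult_integrable[OF assms(2)]
  by (simp add: algebra_simps)

text \<open>Phases have modulus one. If the integrand is not integrable, its Bochner integral is 0
  and the bound is trivial.\<close>

lemma cmod_fourier_le: "ennreal (cmod (fourier f \<xi>)) \<le> L1norm f"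
proof -
  let ?h = "\<lambda>x. exp (- (\<i> * complex_of_real (x \<bullet> \<xi>))) * f x"
  have "ennreal (cmod (integral\<^sup>L lebesgue ?h)) \<le> (\<integral>\<^sup>+x. ennreal (cmod (?h x)) \<partial>lebesgue)"
    by (cases "integrable lebesgue ?h") (auto simp: not_integrable_integral_eq intro: integral_norm_bound_ennreal)
  then show ?thesis
    by (simp add: fourier_def L1norm_def norm_mult)
qed

section \<open>Truncations and their mean-square limit\<close>

abbreviation truncate :: "nat \<Rightarrow> ('a::euclidean_space \<Rightarrow> complex) \<Rightarrow> 'a \<Rightarrow> complex" where
  "truncate k f \<equiv> (\<lambda>x. indicator (cball 0 (real k)) x * f x)"

text \<open>On a ball, which has finite measure, |f| \<le> 1 + |f|^2 gives integrability without the
  Cauchy-Schwarz inequality.\<close>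

lemma truncate_L1:
  fixes f :: "'a::euclidean_space \<Rightarrow> complex"
  assumes "f \<in> L2"
  shows "truncate k f \<in> L1"
proof -
  have [measurable]: "f \<in> borel_measurable lebesgue"
    using assms by (simp add: L2_iff)
  have B[measurable]: "cball 0 (real k) \<in> sets (lebesgue :: 'a measure)"
    by (rule lmeasurable_cball[THEN fmeasurableD])
  have "(\<integral>\<^sup>+x. ennreal (cmod (truncate k f x)) \<partial>lebesgue)
      \<le> (\<integral>\<^sup>+x. indicator (cball 0 (real k)) x + ennreal ((cmod (f x))\<^sup>2) \<partial>lebesgue)"
  proof (rule nn_integral_mono)
    fix x
    have "0 \<le> (cmod (f x) - 1)\<^sup>2 + (cmod (f x))\<^sup>2"
      by simp
    then have "cmod (f x) \<le> 1 + (cmod (f x))\<^sup>2"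
      by (simp add: power2_diff)
    then have "ennreal (cmod (f x)) \<le> ennreal 1 + ennreal ((cmod (f x))\<^sup>2)"
      by (subst ennreal_plus[symmetric]) (auto intro: ennreal_leI simp del: ennreal_plus)
    then show "ennreal (cmod (truncate k f x)) \<le> indicator (cball 0 (real k)) x + ennreal ((cmod (f x))\<^sup>2)"
      by (auto split: split_indicator)
  qed
  also have "\<dots> = emeasure lebesgue (cball (0::'a) (real k)) + L2sq f"
    by (simp add: nn_integral_add L2sq_def)
  also have "\<dots> < \<infinity>"
    using assms emeasure_lborel_cball_finite[of "0::'a" "real k"] by (auto simp: L2_iff)
  finally show ?thesis
    by (simp add: L1_def L1norm_def)
qed

text \<open>Dominated convergence with majorant |f|^2: each point lies in all balls of sufficiently
  large radius.\<close>

lemma L2sq_tail_tendsto_0: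
  fixes f :: "'a::euclidean_space \<Rightarrow> complex"
  assumes "f \<in> L2"
  shows "(\<lambda>k::nat. \<integral>\<^sup>+x\<in>- cball 0 (real k). ennreal ((cmod (f x))\<^sup>2) \<partial>lebesgue) \<longlonglongrightarrow> 0"
proof -
  have [measurable]: "f \<in> borel_measurable lebesgue" and fin: "L2sq f < \<infinity>"
    using assms by (auto simp: L2_iff)
  have [measurable]: "cball 0 (real k) \<in> sets (lebesgue :: 'a measure)" for k
    by (rule lmeasurable_cball[THEN fmeasurableD])
  have "(\<lambda>k::nat. \<integral>\<^sup>+x\<in>- cball 0 (real k). ennreal ((cmod (f x))\<^sup>2) \<partial>lebesgue)
      \<longlonglongrightarrow> (\<integral>\<^sup>+x. 0 \<partial>(lebesgue :: 'a measure))"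
  proof (rule nn_integral_dominated_convergence[where w="\<lambda>x. ennreal ((cmod (f x))\<^sup>2)"])
    show "AE x in lebesgue. (\<lambda>k. ennreal ((cmod (f x))\<^sup>2) * indicator (- cball 0 (real k)) x) \<longlonglongrightarrow> 0"
    proof (rule AE_I2)
      fix x :: 'a
      have "eventually (\<lambda>k::nat. ennreal ((cmod (f x))\<^sup>2) * indicator (- cball 0 (real k)) x = 0) sequentially"
        by (rule eventually_sequentiallyI[of "nat \<lceil>norm x\<rceil>"]) (auto split: split_indicator simp: nat_le_iff ceiling_le_iff)
      then show "(\<lambda>k. ennreal ((cmod (f x))\<^sup>2) * indicator (- cball 0 (real k)) x) \<longlonglongrightarrow> 0"
        by (rule tendsto_eventually)
    qed
  qed (use fin in \<open>auto simp: L2sq_def split: split_indicator\<close>)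
  then show ?thesis
    by simp
qed

text \<open>Plancherel's inequality makes the transforms of the truncations a Cauchy sequence, and
  completeness provides the limit. This legitimises the choice in \<open>fourier_L2\<close>.\<close>

lemma has_fourier_L2_exists:
  fixes f :: "'a::euclidean_space \<Rightarrow> complex"
  assumes f: "f \<in> L2"
  shows "\<exists>g. has_fourier_L2 f g"
proof -
  let ?F = "\<lambda>k. fourier (truncate k f)"
  let ?c = "ennreal ((2 * pi) ^ DIM('a))"
  have fm: "f \<in> borel_measurable lebesgue"
    using f by (auto simp: L2_iff)
  have T: "truncate k f \<in> borel_measurable lebesgue" for k
    using truncate_L1[OF f, of k] by (simp add: L1_def)
  have F: "?F k \<in> borel_measurable lebesgue" for k
    by (rule fourier_measurable[OF T])
  have "\<exists>g\<in>borel_measurable lebesgue. (\<lambda>n. \<integral>\<^sup>+x. ennreal ((cmod (?F n x - g x))\<^sup>2) \<partial>lebesgue) \<longlonglongrightarrow> 0"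
  proof (rule L2_complete[OF F])
    fix e :: real
    assume "e > 0"
    let ?t = "\<lambda>k::nat. \<integral>\<^sup>+x\<in>- cball 0 (real k). ennreal ((cmod (f x))\<^sup>2) \<partial>lebesgue"
    have "(\<lambda>k. ?c * ?t k) \<longlonglongrightarrow> ?c * 0"
      by (intro ennreal_tendsto_cmult L2sq_tail_tendsto_0 f) auto
    then have "eventually (\<lambda>k. ?c * ?t k < ennreal e) sequentially"
      using \<open>e > 0\<close> by (auto simp: order_tendsto_iff)
    then obtain N where N: "?c * ?t N < ennreal e"
      by (auto dest: eventually_happens)
    have "L2sq (\<lambda>\<xi>. ?F m \<xi> - ?F n \<xi>) \<le> ennreal e" if "m \<ge> N" "n \<ge> N" for m n
    proof -
      have "L2sq (\<lambda>\<xi>. ?F m \<xi> - ?F n \<xi>) = L2sq (fourier (\<lambda>x. truncate m f x - truncate n f x))"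
        by (subst fourier_diff[OF truncate_L1[OF f] truncate_L1[OF f]]) simp
      also have "\<dots> \<le> ?c * L2sq (\<lambda>x. truncate m f x - truncate n f x)"
        using truncate_L1[OF f] by (intro fourier_plancherel_le) (auto simp: L1_iff)
      \<comment> \<open>For m, n \<ge> N the two truncations agree on the ball of radius
        \<open>N\<close>; outside it their difference is 0, f or - f.\<close>
      also have "\<dots> \<le> ?c * ?t N"
        unfolding L2sq_def using that
        by (intro mult_left_mono nn_integral_mono) (auto split: split_indicator)
      finally show ?thesis
        using N by simp
    qed
    then show "\<exists>N. \<forall>m\<ge>N. \<forall>n\<ge>N. (\<integral>\<^sup>+x. ennreal ((cmod (?F m x - ?F n x))\<^sup>2) \<partial>lebesgue) \<le> ennreal e"
      unfolding L2sq_def by blast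
  qed
  then obtain g where g: "g \<in> borel_measurable lebesgue"
    and lim: "(\<lambda>n. L2sq (\<lambda>x. ?F n x - g x)) \<longlonglongrightarrow> 0"
    by (auto simp: L2sq_def)
  \<comment> \<open>One truncation whose transform is within finite distance of the limit suffices
    to show that the limit is square integrable.\<close>
  have "eventually (\<lambda>n. L2sq (\<lambda>x. ?F n x - g x) < 1) sequentially"
    using lim by (rule order_tendstoD) simp
  then obtain n where n: "L2sq (\<lambda>x. ?F n x - g x) < 1"
    by (auto dest: eventually_happens)
  have "L2sq g = L2sq (\<lambda>x. ?F n x + (g x - ?F n x))"
    by simp
  also have "\<dots> \<le> 2 * L2sq (?F n) + 2 * L2sq (\<lambda>x. g x - ?F n x)"
    using F g by (intro L2sq_add_le) auto
  also have "L2sq (\<lambda>x. g x - ?F n x) = L2sq (\<lambda>x. ?F n x - g x)"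
    by (simp add: L2sq_def norm_minus_commute)
  also have "2 * L2sq (?F n) + 2 * L2sq (\<lambda>x. ?F n x - g x) < \<infinity>"
  proof -
    have "L2sq (?F n) \<le> ?c * L2sq (truncate n f)"
      by (intro fourier_plancherel_le truncate_L1 f)
    also have "\<dots> \<le> ?c * L2sq f"
      unfolding L2sq_def by (intro mult_left_mono nn_integral_mono) (auto split: split_indicator)
    also have "\<dots> < \<infinity>"
      using f by (auto simp: L2_iff ennreal_mult_less_top)
    finally show ?thesis
      using n by (auto simp: ennreal_mult_less_top intro: less_trans)
  qed
  finally have "g \<in> L2"
    using g by (simp add: L2_iff)
  then show ?thesis
    unfolding has_fourier_L2_def tendsto_L2norm_0_iff using lim by auto
qed

lemma has_fourier_L2_fourier_L2:
  assumes "f \<in> L2"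
  shows "has_fourier_L2 f (fourier_L2 f)"
  unfolding fourier_L2_def using has_fourier_L2_exists[OF assms] by (rule someI_ex)

text \<open>A bound uniform over the truncations survives the mean-square limit, up to a factor 2.
  It is used with the whole space, for a Plancherel bound, and with small balls.\<close>

lemma fourier_L2_set_bound:
  fixes f :: "'a::euclidean_space \<Rightarrow> complex"
  assumes f: "f \<in> L2" and B: "B \<in> sets lebesgue"
    and c: "\<And>k. (\<integral>\<^sup>+\<xi>\<in>B. ennreal ((cmod (fourier (truncate k f) \<xi>))\<^sup>2) \<partial>lebesgue) \<le> c"
  shows "(\<integral>\<^sup>+\<xi>\<in>B. ennreal ((cmod (fourier_L2 f \<xi>))\<^sup>2) \<partial>lebesgue) \<le> 2 * c"
proof -
  let ?F = "\<lambda>k. fourier (truncate k f)" and ?g = "fourier_L2 f"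
  note g = has_fourier_L2_fourier_L2[OF f, unfolded has_fourier_L2_def tendsto_L2norm_0_iff]
  have gm: "?g \<in> borel_measurable lebesgue"
    using g by (simp add: L2_iff)
  have F: "?F k \<in> borel_measurable lebesgue" for k
    using truncate_L1[OF f, of k] by (intro fourier_measurable) (simp add: L1_def)
  have le: "(\<integral>\<^sup>+\<xi>\<in>B. ennreal ((cmod (?g \<xi>))\<^sup>2) \<partial>lebesgue) \<le> 2 * c + 2 * L2sq (\<lambda>\<xi>. ?F k \<xi> - ?g \<xi>)" for k
  proof -
    have "(\<integral>\<^sup>+\<xi>\<in>B. ennreal ((cmod (?F k \<xi> + (?g \<xi> - ?F k \<xi>)))\<^sup>2) \<partial>lebesgue)
      \<le> 2 * (\<integral>\<^sup>+\<xi>\<in>B. ennreal ((cmod (?F k \<xi>))\<^sup>2) \<partial>lebesgue)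
        + 2 * (\<integral>\<^sup>+\<xi>\<in>B. ennreal ((cmod (?g \<xi> - ?F k \<xi>))\<^sup>2) \<partial>lebesgue)"
      using F gm by (intro set_L2sq_add_le B) auto
    also have "\<dots> \<le> 2 * c + 2 * L2sq (\<lambda>\<xi>. ?F k \<xi> - ?g \<xi>)"
      unfolding L2sq_def
      by (intro add_mono mult_left_mono c nn_integral_mono) (auto simp: norm_minus_commute split: split_indicator)
    finally show ?thesis
      by simp
  qed
  have "(\<lambda>k. 2 * c + 2 * L2sq (\<lambda>\<xi>. ?F k \<xi> - ?g \<xi>)) \<longlonglongrightarrow> 2 * c + 2 * 0"
    using g by (intro tendsto_intros ennreal_tendsto_cmult) auto
  then show ?thesis
    using le by (intro LIMSEQ_le_const) auto
qed

lemma L2sq_fourier_L2_le: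
  fixes f :: "'a::euclidean_space \<Rightarrow> complex"
  assumes f: "f \<in> L2"
  shows "L2sq (fourier_L2 f) \<le> 2 * (ennreal ((2 * pi) ^ DIM('a)) * L2sq f)"
proof -
  have "(\<integral>\<^sup>+\<xi>\<in>UNIV. ennreal ((cmod (fourier (truncate k f) \<xi>))\<^sup>2) \<partial>lebesgue)
      \<le> ennreal ((2 * pi) ^ DIM('a)) * L2sq f" for k
  proof -
    have "L2sq (fourier (truncate k f)) \<le> ennreal ((2 * pi) ^ DIM('a)) * L2sq (truncate k f)"
      by (intro fourier_plancherel_le truncate_L1 f)
    also have "\<dots> \<le> ennreal ((2 * pi) ^ DIM('a)) * L2sq f"
      unfolding L2sq_def by (intro mult_left_mono nn_integral_mono) (auto split: split_indicator)
    finally show ?thesis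
      by (simp add: L2sq_def)
  qed
  from fourier_L2_set_bound[OF f _ this] show ?thesis
    by (simp add: L2sq_def)
qed

text \<open>The transforms of all truncations are bounded pointwise by \<open>L1norm f\<close>.
  Passing to the limit gives the local estimate directly, without identifying
  \<open>fourier_L2 f\<close> with \<open>fourier f\<close>.\<close>

lemma fourier_L2_local_bound:
  fixes f :: "'a::euclidean_space \<Rightarrow> complex"
  assumes f: "f \<in> L2" and B: "B \<in> sets lebesgue"
  shows "(\<integral>\<^sup>+\<xi>\<in>B. ennreal ((cmod (fourier_L2 f \<xi>))\<^sup>2) \<partial>lebesgue) \<le> 2 * ((L1norm f)\<^sup>2 * emeasure lebesgue B)"
proof (rule fourier_L2_set_bound[OF f B])
  fix k
  have "ennreal ((cmod (fourier (truncate k f) \<xi>))\<^sup>2) \<le> (L1norm f)\<^sup>2" for \<xi>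
  proof -
    have "ennreal (cmod (fourier (truncate k f) \<xi>)) \<le> L1norm (truncate k f)"
      by (rule cmod_fourier_le)
    also have "\<dots> \<le> L1norm f"
      unfolding L1norm_def by (intro nn_integral_mono) (auto split: split_indicator)
    finally show ?thesis
      by (auto simp: power2_eq_square ennreal_mult intro: mult_mono)
  qed
  then have "(\<integral>\<^sup>+\<xi>\<in>B. ennreal ((cmod (fourier (truncate k f) \<xi>))\<^sup>2) \<partial>lebesgue)
      \<le> (\<integral>\<^sup>+\<xi>\<in>B. (L1norm f)\<^sup>2 \<partial>lebesgue)"
    by (intro nn_integral_mono mult_right_mono) auto
  also have "\<dots> = (L1norm f)\<^sup>2 * emeasure lebesgue B"
    by (rule nn_integral_cmult_indicator[OF B])
  finally show "(\<integral>\<^sup>+\<xi>\<in>B. ennreal ((cmod (fourier (truncate k f) \<xi>))\<^sup>2) \<partial>lebesgue)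
      \<le> (L1norm f)\<^sup>2 * emeasure lebesgue B" .
qed

section \<open>Radial integrals\<close>

text \<open>Polar coordinates for radial functions, obtained without surface measure: on {..a} with
  a \<ge> 0 the left side is the volume V a^n of a ball and the right side the integral of its
  derivative. Such half-lines form an intersection-stable generator.\<close>

lemma distr_norm_lborel:
  "distr (lborel :: 'a::euclidean_space measure) borel norm
    = density lborel (\<lambda>r. ennreal (DIM('a) * unit_ball_vol DIM('a) * r ^ (DIM('a) - 1)) * indicator {0..} r)"
  (is "?M = ?N")
proof (rule measure_eqI_generator_eq)
  let ?n = "DIM('a)" and ?V = "unit_ball_vol (real DIM('a))"
  show "Int_stable (range (\<lambda>a::real. {..a}))"
    by (auto simp: Int_stable_def)
  show "sets ?M = sigma_sets UNIV (range (\<lambda>a::real. {..a}))" "sets ?N = sigma_sets UNIV (range (\<lambda>a::real. {..a}))"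
    by (simp_all add: borel_eq_atMost)
  have M: "emeasure ?M {..a} = (if a < 0 then 0 else ennreal (?V * a ^ ?n))" for a :: real
  proof -
    have "emeasure ?M {..a} = emeasure lborel (cball (0::'a) a)"
      by (subst emeasure_distr) (auto intro!: arg_cong2[where f=emeasure] simp: cball_def)
    then show ?thesis
      by (auto simp: emeasure_cball)
  qed
  have N: "emeasure ?N {..a} = (if a < 0 then 0 else ennreal (?V * a ^ ?n))" for a :: real
  proof -
    have "emeasure ?N {..a} = (\<integral>\<^sup>+r. ennreal (?n * ?V * r ^ (?n - 1)) * indicator {0..a} r \<partial>lborel)"
      by (subst emeasure_density) (auto intro!: nn_integral_cong split: split_indicator)
    also have "\<dots> = (if a < 0 then 0 else ennreal (?V * a ^ ?n))"
    proof (cases "a < 0")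
      case False
      have "(\<integral>\<^sup>+r. ennreal (?n * ?V * r ^ (?n - 1)) * indicator {0..a} r \<partial>lborel)
          = ennreal (?V * a ^ ?n - ?V * 0 ^ ?n)"
        by (rule nn_integral_FTC_Icc) (use False in \<open>auto intro!: derivative_eq_intros\<close>)
      then show ?thesis
        using False by simp
    qed auto
    finally show ?thesis .
  qed
  show "emeasure ?M X = emeasure ?N X" if "X \<in> range (\<lambda>a::real. {..a})" for X
    using that by (auto simp only: M N)
  show "range (\<lambda>i::nat. {..real i}) \<subseteq> range (\<lambda>a::real. {..a})"
    by auto
  show "(\<Union>i::nat. {..real i}) = UNIV"
    using real_arch_simple by auto
  show "emeasure ?M {..real i} \<noteq> \<infinity>" for i
    by (simp add: M)
qed auto

lemma nn_integral_norm:
  fixes f :: "real \<Rightarrow> ennreal"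
  assumes [measurable]: "f \<in> borel_measurable borel"
  shows "(\<integral>\<^sup>+x. f (norm (x::'a::euclidean_space)) \<partial>lebesgue)
    = ennreal (DIM('a) * unit_ball_vol DIM('a)) * (\<integral>\<^sup>+r\<in>{0..}. ennreal (r ^ (DIM('a) - 1)) * f r \<partial>lborel)"
proof -
  let ?c = "DIM('a) * unit_ball_vol DIM('a)"
  have "(\<integral>\<^sup>+x. f (norm (x::'a)) \<partial>lebesgue) = (\<integral>\<^sup>+r. f r \<partial>distr (lborel :: 'a measure) borel norm)"
    by (simp add: nn_integral_completion nn_integral_distr)
  also have "\<dots> = (\<integral>\<^sup>+r. ennreal (?c * r ^ (DIM('a) - 1)) * indicator {0..} r * f r \<partial>lborel)"
    unfolding distr_norm_lborel by (subst nn_integral_density) auto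
  also have "\<dots> = (\<integral>\<^sup>+r. ennreal ?c * (ennreal (r ^ (DIM('a) - 1)) * f r * indicator {0..} r) \<partial>lborel)"
    by (intro nn_integral_cong) (auto simp: ennreal_mult mult_ac split: split_indicator)
  finally show ?thesis
    by (simp add: nn_integral_cmult)
qed

text \<open>It is enough to have an explicit primitive of a minorant. As the minorant may change
  sign, the comparison is made between gauge integrals before passing to the nonnegative integral of
  \<open>f\<close>.\<close>

lemma nn_integral_Icc_ge:
  fixes f G :: "real \<Rightarrow> real"
  assumes ab: "a \<le> b" and f: "continuous_on {a..b} f"
    and G: "\<And>x. x \<in> {a..b} \<Longrightarrow> (G has_real_derivative g x) (at x)"
    and gf: "\<And>x. x \<in> {a..b} \<Longrightarrow> g x \<le> f x" and f0: "\<And>x. x \<in> {a..b} \<Longrightarrow> 0 \<le> f x"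
  shows "ennreal (G b - G a) \<le> (\<integral>\<^sup>+x\<in>{a..b}. ennreal (f x) \<partial>lborel)"
proof -
  have 1: "(g has_integral (G b - G a)) {a..b}"
    using G ab by (intro fundamental_theorem_of_calculus)
      (auto simp: has_real_derivative_iff_has_vector_derivative[symmetric] intro: DERIV_subset)
  have 2: "(f has_integral (integral {a..b} f)) {a..b}"
    using f by (intro integrable_integral integrable_continuous_interval)
  have "(\<integral>\<^sup>+x\<in>{a..b}. ennreal (f x) \<partial>lborel) = (\<integral>\<^sup>+x. ennreal (indicator {a..b} x * f x) \<partial>lborel)"
    by (intro nn_integral_cong) (auto split: split_indicator)
  also have "\<dots> = ennreal (integral {a..b} f)"
    using nn_integral_has_integral_lebesgue[OF f0 2] by (simp add: mult.commute)
  finally show ?thesis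
    using has_integral_le[OF 1 2 gf] by (simp add: ennreal_leI)
qed

lemma nn_integral_powr_from_0:
  assumes "a > -1" "c \<ge> 0"
  shows "(\<integral>\<^sup>+r\<in>{0..c}. ennreal (r powr a) \<partial>lborel) = ennreal (c powr (a + 1) / (a + 1))"
  using nn_integral_has_integral_lebesgue[OF _ has_integral_powr_from_0[OF assms]]
  by (simp add: mult.commute ennreal_indicator[symmetric] ennreal_mult'[symmetric])

text \<open>The factor multiplying |Fw|^2 in the squared modulus of the \<open>u\<^sub>1\<close>
  term of \<open>wave_hat\<close>, as a function of r = |\<xi>|.\<close>

definition wave_kernel :: "real \<Rightarrow> real \<Rightarrow> real \<Rightarrow> real" where
  "wave_kernel s t r = (sin (r * t) / r)\<^sup>2 * r powr (- 2 * s)"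

lemma wave_kernel_nonneg: "0 \<le> wave_kernel s t r"
  by (simp add: wave_kernel_def)

lemma wave_kernel_measurable[measurable]: "wave_kernel s t \<in> borel_measurable borel"
  unfolding wave_kernel_def[abs_def] by measurable

lemma nn_integral_wave_kernel:
  "(\<integral>\<^sup>+x\<in>cball 0 R. ennreal (wave_kernel s t (norm (x::'a::euclidean_space))) \<partial>lebesgue)
    = ennreal (DIM('a) * unit_ball_vol DIM('a)) *
      (\<integral>\<^sup>+r\<in>{0..R}. ennreal (r ^ (DIM('a) - 1) * wave_kernel s t r) \<partial>lborel)"
proof -
  have "(\<integral>\<^sup>+x\<in>cball 0 R. ennreal (wave_kernel s t (norm (x::'a))) \<partial>lebesgue)
      = (\<integral>\<^sup>+x. ennreal (wave_kernel s t (norm (x::'a))) * indicator {..R} (norm x) \<partial>lebesgue)"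
    by (intro nn_integral_cong) (auto split: split_indicator)
  also have "\<dots> = ennreal (DIM('a) * unit_ball_vol DIM('a)) * (\<integral>\<^sup>+r\<in>{0..}. ennreal (r ^ (DIM('a) - 1)) *
      (ennreal (wave_kernel s t r) * indicator {..R} r) \<partial>lborel)"
    by (rule nn_integral_norm) measurable
  also have "(\<integral>\<^sup>+r\<in>{0..}. ennreal (r ^ (DIM('a) - 1)) * (ennreal (wave_kernel s t r) * indicator {..R} r) \<partial>lborel)
      = (\<integral>\<^sup>+r\<in>{0..R}. ennreal (r ^ (DIM('a) - 1) * wave_kernel s t r) \<partial>lborel)"
    by (intro nn_integral_cong) (auto simp: ennreal_mult wave_kernel_nonneg split: split_indicator)
  finally show ?thesis .
qed

section \<open>Pointwise bounds for the radial weight\<close>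

lemma radial_weight_eq:
  assumes r: "r > 0" and n: "n \<ge> 1"
  shows "r ^ (n - 1) * wave_kernel s t r = (sin (r * t))\<^sup>2 * r powr (real n - 3 - 2 * s)"
proof -
  have 1: "r ^ (n - 1) = r powr (real n - 1)"
    using powr_realpow[OF r, of "n - 1"] n by (simp add: of_nat_diff)
  have "r powr (real n - 1) * r powr (- 2 * s) = r powr (real n - 3 - 2 * s) * r powr 2"
    unfolding powr_add[symmetric] by (simp add: algebra_simps)
  then have 2: "r powr (real n - 1) * r powr (- 2 * s) = r powr (real n - 3 - 2 * s) * r\<^sup>2"
    using r by simp
  have "r ^ (n - 1) * wave_kernel s t r = (sin (r * t))\<^sup>2 / r\<^sup>2 * (r powr (real n - 1) * r powr (- 2 * s))"
    unfolding 1 wave_kernel_def power_divide by (simp only: mult_ac)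
  also have "\<dots> = (sin (r * t))\<^sup>2 * r powr (real n - 3 - 2 * s)"
    unfolding 2 using r by simp
  finally show ?thesis .
qed

text \<open>The derivative cos y - 1/2 is nonnegative up to pi / 3, which exceeds 1.\<close>

lemma sin_ge_half:
  assumes "0 \<le> x" "x \<le> (1::real)"
  shows "x / 2 \<le> sin x"
proof -
  have "(\<lambda>x. sin x - x / 2) 0 \<le> (\<lambda>x. sin x - x / 2) x"
  proof (rule DERIV_nonneg_imp_nondecreasing[OF assms(1)], intro exI conjI)
    fix y
    assume y: "0 \<le> y" "y \<le> x"
    show "((\<lambda>x. sin x - x / 2) has_real_derivative cos y - 1 / 2) (at y)"
      by (auto intro!: derivative_eq_intros)
    have "cos (pi / 3) \<le> cos y"
      using y assms pi_gt3 by (intro cos_monotone_0_pi_le) auto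
    then show "0 \<le> cos y - 1 / 2"
      by (simp add: cos_60)
  qed
  then show ?thesis
    by simp
qed

text \<open>The two bounds come from |sin x| \<le> |x| and |sin x| \<le> 1, and they cross at r = 1
  / t. The first power is integrable at 0 exactly when n > 2 s, the second exactly when n > 2 + 2 s;
  this is the origin of the ranges in \<open>D_rate\<close>.\<close>

lemma radial_weight_le:
  assumes "0 < r" "1 \<le> n"
  shows "r ^ (n - 1) * wave_kernel s t r \<le> t\<^sup>2 * r powr (real n - 1 - 2 * s)"
    and "r ^ (n - 1) * wave_kernel s t r \<le> r powr (real n - 3 - 2 * s)"
proof -
  have "(sin (r * t))\<^sup>2 \<le> (r * t)\<^sup>2"
    using abs_sin_x_le_abs_x[of "r * t"] by (simp add: abs_le_square_iff)
  then have "(sin (r * t))\<^sup>2 * r powr (real n - 3 - 2 * s) \<le> (r * t)\<^sup>2 * r powr (real n - 3 - 2 * s)"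
    by (intro mult_right_mono) auto
  also have "\<dots> = t\<^sup>2 * (r powr 2 * r powr (real n - 3 - 2 * s))"
    using assms by (simp add: power_mult_distrib)
  also have "\<dots> = t\<^sup>2 * r powr (real n - 1 - 2 * s)"
    unfolding powr_add[symmetric] by (simp add: algebra_simps)
  finally show "r ^ (n - 1) * wave_kernel s t r \<le> t\<^sup>2 * r powr (real n - 1 - 2 * s)"
    unfolding radial_weight_eq[OF assms] .
  show "r ^ (n - 1) * wave_kernel s t r \<le> r powr (real n - 3 - 2 * s)"
    unfolding radial_weight_eq[OF assms] by (rule mult_left_le_one_le) (auto simp: abs_square_le_1)
qed

lemma radial_weight_ge:
  assumes "0 < r" "1 \<le> n" "0 < t" "r * t \<le> 1"
  shows "t\<^sup>2 / 4 * r powr (real n - 1 - 2 * s) \<le> r ^ (n - 1) * wave_kernel s t r"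
proof -
  have "((r * t) / 2)\<^sup>2 \<le> (sin (r * t))\<^sup>2"
    using assms by (intro power_mono sin_ge_half) auto
  then have "((r * t) / 2)\<^sup>2 * r powr (real n - 3 - 2 * s) \<le> (sin (r * t))\<^sup>2 * r powr (real n - 3 - 2 * s)"
    by (intro mult_right_mono) auto
  also have "((r * t) / 2)\<^sup>2 * r powr (real n - 3 - 2 * s) = t\<^sup>2 / 4 * (r powr 2 * r powr (real n - 3 - 2 * s))"
    using assms by (simp add: power_mult_distrib power_divide)
  also have "\<dots> = t\<^sup>2 / 4 * r powr (real n - 1 - 2 * s)"
    unfolding powr_add[symmetric] by (simp add: algebra_simps)
  finally show ?thesis
    unfolding radial_weight_eq[OF assms(1,2)] .
qed

lemma nn_integral_Icc_0_mono:
  fixes f g :: "real \<Rightarrow> real"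
  assumes "\<And>r. 0 < r \<Longrightarrow> r \<le> R \<Longrightarrow> f r \<le> g r"
  shows "(\<integral>\<^sup>+r\<in>{0..R}. ennreal (f r) \<partial>lborel) \<le> (\<integral>\<^sup>+r\<in>{0..R}. ennreal (g r) \<partial>lborel)"
proof (rule nn_integral_mono_AE)
  show "AE r in lborel. ennreal (f r) * indicator {0..R} r \<le> ennreal (g r) * indicator {0..R} r"
    using AE_lborel_singleton[of 0]
    by eventually_elim (auto split: split_indicator intro!: ennreal_leI assms)
qed

lemma D_rate_power2:
  assumes "t \<ge> 1"
  shows "(D_rate n s t)\<^sup>2 = (if real n < 2 + 2 * s then t powr (2 + 2 * s - real n)
    else if real n = 2 + 2 * s then ln t else 1)"
proof -
  have "(t powr (1 + s - real n / 2))\<^sup>2 = t powr (2 + 2 * s - real n)"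
    unfolding power2_eq_square powr_add[symmetric] by (simp add: algebra_simps)
  then show ?thesis
    using assms by (simp add: D_rate_def)
qed

text \<open>The zone r \<le> 1 / t is where the sine is comparable to its argument. Its contribution
  serves both the upper bound and the subcritical lower bound.\<close>

lemma near_kernel_integral:
  assumes n: "1 \<le> n" and s: "2 * s < real n" and t: "0 < t"
  shows "(\<integral>\<^sup>+r\<in>{0..1/t}. ennreal (t\<^sup>2 * r powr (real n - 1 - 2 * s)) \<partial>lborel)
    = ennreal (t powr (2 + 2 * s - real n) / (real n - 2 * s))"
proof -
  have "(\<integral>\<^sup>+r\<in>{0..1/t}. ennreal (t\<^sup>2 * r powr (real n - 1 - 2 * s)) \<partial>lborel)
      = ennreal (t\<^sup>2) * (\<integral>\<^sup>+r\<in>{0..1/t}. ennreal (r powr (real n - 1 - 2 * s)) \<partial>lborel)"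
    by (subst nn_integral_cmult[symmetric]) (auto simp: ennreal_mult mult.assoc)
  also have "\<dots> = ennreal (t\<^sup>2) * ennreal ((1 / t) powr (real n - 2 * s) / (real n - 2 * s))"
    using s t by (subst nn_integral_powr_from_0) auto
  also have "\<dots> = ennreal (t powr 2 * t powr (2 * s - real n) / (real n - 2 * s))"
  proof -
    have "(1 / t) powr (real n - 2 * s) = t powr (2 * s - real n)"
      using t powr_minus_divide[of t "real n - 2 * s"] by (simp add: powr_divide)
    then show ?thesis
      using s t by (simp flip: ennreal_mult)
  qed
  also have "t powr 2 * t powr (2 * s - real n) = t powr (2 + 2 * s - real n)"
    unfolding powr_add[symmetric] by (simp add: algebra_simps)
  finally show ?thesis .
qed

text \<open>The integral is split at r = 1 / t, where the two pointwise bounds cross.\<close>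

lemma wave_kernel_upper_radial:
  assumes n: "1 \<le> n" and s: "2 * s < real n"
  shows "\<exists>C>0. \<forall>t\<ge>exp 1. (\<integral>\<^sup>+r\<in>{0..1}. ennreal (r ^ (n - 1) * wave_kernel s t r) \<partial>lborel)
    \<le> ennreal (C * (D_rate n s t)\<^sup>2)"
proof -
  \<comment> \<open>The sign of \<open>q\<close> distinguishes the three ranges: negative for a
    power, zero for the logarithm, positive for a constant rate.\<close>
  define q where "q = real n - 2 - 2 * s"
  \<comment> \<open>The integral of r^(q - 1) over [1/t, 1] is ln t if q = 0 and (1 - t^(-q)) / q
    otherwise; \<open>K\<close> bounds it relative to the squared rate.\<close>
  define K where "K = (if q = 0 then 1 else 1 / \<bar>q\<bar>)"
  define C where "C = 1 / (real n - 2 * s) + K"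
  have K: "K > 0"
    by (simp add: K_def)
  have "(\<integral>\<^sup>+r\<in>{0..1}. ennreal (r ^ (n - 1) * wave_kernel s t r) \<partial>lborel)
      \<le> ennreal (C * (D_rate n s t)\<^sup>2)" if t: "t \<ge> exp 1" for t
  proof -
    have t1: "t \<ge> 1"
      using t exp_ge_add_one_self[of 1] by linarith
    have lnt: "ln t \<ge> 1"
      using t t1 by (subst ln_ge_iff) auto
    \<comment> \<open>The near zone contributes a multiple of t^(-q). This is the squared rate
      itself when q < 0 and at most 1 otherwise, while ln t \<ge> 1 keeps the squared rate at least
      1.\<close>
    have D1: "(D_rate n s t)\<^sup>2 \<ge> t powr (- q)"
    proof (cases "q < 0")
      case True
      have "- q = 2 + 2 * s - real n"
        by (simp add: q_def)
      then show ?thesis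
        using t1 True by (simp add: D_rate_power2)
    next
      case False
      then have "t powr (- q) \<le> 1"
        using t1 powr_mono[of "- q" 0 t] by simp
      also have "1 \<le> (D_rate n s t)\<^sup>2"
      proof -
        have "\<not> real n < 2 + 2 * s"
          using False by (simp add: q_def)
        then show ?thesis
          using t1 lnt by (simp add: D_rate_power2)
      qed
      finally show ?thesis .
    qed
    have pos: "0 < r" if "1 / t \<le> r" for r
      using that t1 by (auto intro: less_le_trans[of 0 "1 / t"])
    have far: "(\<integral>\<^sup>+r\<in>{1/t..1}. ennreal (r powr (q - 1)) \<partial>lborel) \<le> ennreal (K * (D_rate n s t)\<^sup>2)"
    proof (cases "q = 0")
      case True
      have "(\<integral>\<^sup>+r. ennreal (r powr (q - 1)) * indicator {1/t..1} r \<partial>lborel) = ennreal (ln 1 - ln (1 / t))"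
        by (rule nn_integral_FTC_Icc)
           (use t1 True pos in \<open>auto intro!: derivative_eq_intros simp: powr_minus inverse_eq_divide pos[THEN less_imp_le]\<close>)
      also have "ln 1 - ln (1 / t) = K * (D_rate n s t)\<^sup>2"
      proof -
        have "real n = 2 + 2 * s"
          using True by (simp add: q_def)
        then show ?thesis
          using t1 True by (simp add: D_rate_power2 K_def ln_div)
      qed
      finally show ?thesis
        by simp
    next
      case False
      have "(\<integral>\<^sup>+r. ennreal (r powr (q - 1)) * indicator {1/t..1} r \<partial>lborel) = ennreal (1 powr q / q - (1 / t) powr q / q)"
        by (rule nn_integral_FTC_Icc)
           (use t1 False pos in \<open>auto intro!: derivative_eq_intros simp: powr_diff\<close>)
      also have "1 powr q / q - (1 / t) powr q / q = (1 - t powr (- q)) / q"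
        using t1 by (simp add: powr_divide powr_minus_divide diff_divide_distrib)
      also have "\<dots> \<le> K * (D_rate n s t)\<^sup>2"
      proof (cases "q < 0")
        case True
        have "- q = 2 + 2 * s - real n"
          by (simp add: q_def)
        then have "K * (D_rate n s t)\<^sup>2 = t powr (- q) / (- q)"
          using t1 True by (simp add: D_rate_power2 K_def)
        moreover have "(1 - t powr (- q)) / q = t powr (- q) / (- q) + 1 / q"
          by (simp add: diff_divide_distrib)
        ultimately show ?thesis
          using True by (simp add: divide_neg_pos)
      next
        case q: False
        then have "2 + 2 * s < real n"
          using False by (simp add: q_def)
        then have "K * (D_rate n s t)\<^sup>2 = 1 / q"
          using t1 q False by (simp add: D_rate_power2 K_def)
        then show ?thesis
          using q False by (simp add: divide_right_mono)
      qed
      finally show ?thesis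
        by (auto intro: ennreal_leI)
    qed
    have "(\<integral>\<^sup>+r\<in>{0..1}. ennreal (r ^ (n - 1) * wave_kernel s t r) \<partial>lborel)
        \<le> (\<integral>\<^sup>+r. ennreal (t\<^sup>2 * r powr (real n - 1 - 2 * s)) * indicator {0..1/t} r
             + ennreal (r powr (q - 1)) * indicator {1/t..1} r \<partial>lborel)"
    proof (rule nn_integral_mono_AE)
      show "AE r in lborel. ennreal (r ^ (n - 1) * wave_kernel s t r) * indicator {0..1} r
        \<le> ennreal (t\<^sup>2 * r powr (real n - 1 - 2 * s)) * indicator {0..1/t} r
             + ennreal (r powr (q - 1)) * indicator {1/t..1} r"
        using AE_lborel_singleton[of 0]
      proof eventually_elim
        case (elim r)
        show ?case
        proof (cases "0 \<le> r \<and> r \<le> 1")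
          case True
          then have r: "0 < r" "r \<le> 1"
            using elim by auto
          have q: "q - 1 = real n - 3 - 2 * s"
            by (simp add: q_def)
          show ?thesis
            using r radial_weight_le[OF r(1) n, of s t]
            by (cases "r \<le> 1 / t") (auto simp: q intro!: ennreal_leI add_increasing2 split: split_indicator)
        qed (auto split: split_indicator)
      qed
    qed
    also have "\<dots> = (\<integral>\<^sup>+r\<in>{0..1/t}. ennreal (t\<^sup>2 * r powr (real n - 1 - 2 * s)) \<partial>lborel)
        + (\<integral>\<^sup>+r\<in>{1/t..1}. ennreal (r powr (q - 1)) \<partial>lborel)"
      by (rule nn_integral_add) auto
    also have "\<dots> \<le> ennreal ((D_rate n s t)\<^sup>2 / (real n - 2 * s)) + ennreal (K * (D_rate n s t)\<^sup>2)"
    proof (rule add_mono[OF _ far])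
      have "t powr (2 + 2 * s - real n) / (real n - 2 * s) \<le> (D_rate n s t)\<^sup>2 / (real n - 2 * s)"
      proof (rule divide_right_mono)
        have "- q = 2 + 2 * s - real n"
          by (simp add: q_def)
        with D1 show "t powr (2 + 2 * s - real n) \<le> (D_rate n s t)\<^sup>2"
          by metis
      qed (use s in simp)
      then show "(\<integral>\<^sup>+r\<in>{0..1/t}. ennreal (t\<^sup>2 * r powr (real n - 1 - 2 * s)) \<partial>lborel)
          \<le> ennreal ((D_rate n s t)\<^sup>2 / (real n - 2 * s))"
        using t1 by (subst near_kernel_integral[OF n s]) (auto intro: ennreal_leI)
    qed
    also have "\<dots> = ennreal (C * (D_rate n s t)\<^sup>2)"
      using s K by (subst ennreal_plus[symmetric]) (auto simp: C_def distrib_right)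
    finally show ?thesis .
  qed
  moreover have "C > 0"
    using s K by (auto simp: C_def intro!: add_pos_pos)
  ultimately show ?thesis
    by blast
qed

section \<open>Lower bounds and divergence of the radial integral\<close>

lemma D_rate_power2_at_top:
  assumes "real n \<le> 2 + 2 * s"
  shows "filterlim (\<lambda>t. (D_rate n s t)\<^sup>2) at_top at_top"
proof (cases "real n = 2 + 2 * s")
  case True
  have "eventually (\<lambda>t. ln t = (D_rate n s t)\<^sup>2) at_top"
    using eventually_ge_at_top[of "1::real"] by eventually_elim (simp add: D_rate_power2 True)
  from this ln_at_top show ?thesis
    by (rule filterlim_cong[THEN iffD1, OF refl refl])
next
  case False
  have "eventually (\<lambda>t. exp ((2 + 2 * s - real n) * ln t) = (D_rate n s t)\<^sup>2) at_top"
    using eventually_ge_at_top[of "1::real"]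
    by eventually_elim (use assms False in \<open>simp add: D_rate_power2 powr_def\<close>)
  moreover have "filterlim (\<lambda>t. exp ((2 + 2 * s - real n) * ln t)) at_top at_top"
    using assms False
    by (intro filterlim_compose[OF exp_at_top] filterlim_tendsto_pos_mult_at_top[OF tendsto_const _ ln_at_top]) auto
  ultimately show ?thesis
    by (rule filterlim_cong[THEN iffD1, OF refl refl])
qed

text \<open>The near zone \<rho> \<le> 1 / t alone already has the order of the squared rate; it
  lies inside [0, r] once t \<ge> 1 / r.\<close>

lemma radial_lower_subcritical:
  assumes n: "1 \<le> n" and s: "2 * s < real n" "real n < 2 + 2 * s" and r: "0 < r"
  shows "\<exists>c>0. \<forall>\<^sub>F t in at_top. ennreal (c * (D_rate n s t)\<^sup>2)
    \<le> (\<integral>\<^sup>+\<rho>\<in>{0..r}. ennreal (\<rho> ^ (n - 1) * wave_kernel s t \<rho>) \<partial>lborel)"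
proof (intro exI conjI)
  \<comment> \<open>The factor 1/4 comes from squaring sin x \<ge> x / 2.\<close>
  show "0 < 1 / (4 * (real n - 2 * s))"
    using s by simp
  show "\<forall>\<^sub>F t in at_top. ennreal (1 / (4 * (real n - 2 * s)) * (D_rate n s t)\<^sup>2)
    \<le> (\<integral>\<^sup>+\<rho>\<in>{0..r}. ennreal (\<rho> ^ (n - 1) * wave_kernel s t \<rho>) \<partial>lborel)"
    using eventually_ge_at_top[of "max 1 (1 / r)"]
  proof eventually_elim
    case (elim t)
    then have t: "1 \<le> t" "1 / t \<le> r"
      using r by (auto simp: field_simps)
    have "ennreal (1 / (4 * (real n - 2 * s)) * (D_rate n s t)\<^sup>2)
        = ennreal (1 / 4) * ennreal (t powr (2 + 2 * s - real n) / (real n - 2 * s))"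
      using t s by (subst ennreal_mult[symmetric]) (auto simp: D_rate_power2)
    also have "\<dots> = ennreal (1 / 4) * (\<integral>\<^sup>+\<rho>\<in>{0..1/t}. ennreal (t\<^sup>2 * \<rho> powr (real n - 1 - 2 * s)) \<partial>lborel)"
      using t by (subst near_kernel_integral[OF n s(1)]) auto
    also have "\<dots> = (\<integral>\<^sup>+\<rho>\<in>{0..1/t}. ennreal (t\<^sup>2 / 4 * \<rho> powr (real n - 1 - 2 * s)) \<partial>lborel)"
      by (subst nn_integral_cmult[symmetric])
        (auto intro!: nn_integral_cong split: split_indicator simp flip: ennreal_mult)
    also have "\<dots> \<le> (\<integral>\<^sup>+\<rho>\<in>{0..1/t}. ennreal (\<rho> ^ (n - 1) * wave_kernel s t \<rho>) \<partial>lborel)"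
      using t by (intro nn_integral_Icc_0_mono radial_weight_ge n) (auto simp: field_simps)
    also have "\<dots> \<le> (\<integral>\<^sup>+\<rho>\<in>{0..r}. ennreal (\<rho> ^ (n - 1) * wave_kernel s t \<rho>) \<partial>lborel)"
      using t by (intro nn_integral_mono) (auto split: split_indicator)
    finally show ?case .
  qed
qed

text \<open>At this exponent the weight is sin^2 (\<rho> t) / \<rho>. Replacing the square of the
  sine by its mean 1/2 on [1/t, r] yields (ln t) / 2 up to bounded terms.\<close>

lemma radial_lower_critical:
  assumes n: "1 \<le> n" and s: "real n = 2 + 2 * s" and r: "0 < r"
  shows "\<exists>c>0. \<forall>\<^sub>F t in at_top. ennreal (c * (D_rate n s t)\<^sup>2)
    \<le> (\<integral>\<^sup>+\<rho>\<in>{0..r}. ennreal (\<rho> ^ (n - 1) * wave_kernel s t \<rho>) \<partial>lborel)"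
proof (intro exI conjI)
  show "\<forall>\<^sub>F t in at_top. ennreal (1 / 4 * (D_rate n s t)\<^sup>2)
    \<le> (\<integral>\<^sup>+\<rho>\<in>{0..r}. ennreal (\<rho> ^ (n - 1) * wave_kernel s t \<rho>) \<partial>lborel)"
    \<comment> \<open>The last threshold means ln t \<ge> 2 - 2 ln r, which is exactly what lets
      half of (ln t) / 2 absorb the constant (ln r - 1) / 2.\<close>
    using eventually_ge_at_top[of "max 1 (max (1 / r) (exp (2 - 2 * ln r)))"]
  proof eventually_elim
    case (elim t)
    then have t: "1 \<le> t" "1 / t \<le> r"
      using r by (auto simp: field_simps)
    have "ln (exp (2 - 2 * ln r)) \<le> ln t"
      using elim t by (subst ln_le_cancel_iff) auto
    then have lnt: "2 - 2 * ln r \<le> ln t"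
      by simp
    \<comment> \<open>The first two terms come from integrating \<open>(1 - cos (2 \<rho> t)) / (2 \<rho>)\<close> by parts; the last one
      makes the derivative of \<open>G\<close> a lower bound for the integrand.\<close>
    define G where "G = (\<lambda>\<rho>. ln \<rho> / 2 - sin (2 * (\<rho> * t)) / (4 * \<rho> * t) + 1 / (4 * \<rho> * t))"
    \<comment> \<open>The two remaining terms of \<open>G r\<close> combine to (1 - sin (2 r t)) /
      (4 r t), which is nonnegative.\<close>
    have "ln r / 2 \<le> G r"
      using r t by (auto simp: G_def field_simps)
    moreover have "G (1 / t) = - ln t / 2 - sin 2 / 4 + 1 / 4"
      using t by (simp add: G_def ln_div)
    then have "G (1 / t) \<le> - ln t / 2 + 1 / 2"
      using sin_ge_minus_one[of "2::real"] by linarith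
    ultimately have "1 / 4 * ln t \<le> G r - G (1 / t)"
      using lnt by simp
    then have "ennreal (1 / 4 * (D_rate n s t)\<^sup>2) \<le> ennreal (G r - G (1 / t))"
      using t s by (intro ennreal_leI) (simp add: D_rate_power2)
    also have "\<dots> \<le> (\<integral>\<^sup>+\<rho>\<in>{1/t..r}. ennreal ((sin (\<rho> * t))\<^sup>2 / \<rho>) \<partial>lborel)"
    proof (rule nn_integral_Icc_ge[OF t(2)])
      have pos: "0 < \<rho>" if "\<rho> \<in> {1/t..r}" for \<rho>
        using that t by (auto intro: less_le_trans[of 0 "1 / t"])
      show "continuous_on {1/t..r} (\<lambda>\<rho>. (sin (\<rho> * t))\<^sup>2 / \<rho>)"
        by (intro continuous_intros ballI) (drule pos, simp)
      fix \<rho>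
      assume \<rho>: "\<rho> \<in> {1/t..r}"
      show "(G has_real_derivative
          1 / (2 * \<rho>) - cos (2 * (\<rho> * t)) / (2 * \<rho>) - (1 - sin (2 * (\<rho> * t))) / (4 * \<rho>\<^sup>2 * t)) (at \<rho>)"
        unfolding G_def using pos[OF \<rho>] t
        by (auto intro!: derivative_eq_intros simp: field_simps power2_eq_square)
      have "1 / (2 * \<rho>) - cos (2 * (\<rho> * t)) / (2 * \<rho>) = (sin (\<rho> * t))\<^sup>2 / \<rho>"
        using pos[OF \<rho>] by (subst cos_double_sin) (simp add: field_simps)
      moreover have "0 \<le> (1 - sin (2 * (\<rho> * t))) / (4 * \<rho>\<^sup>2 * t)"
        using t by simp
      ultimately show "1 / (2 * \<rho>) - cos (2 * (\<rho> * t)) / (2 * \<rho>) - (1 - sin (2 * (\<rho> * t))) / (4 * \<rho>\<^sup>2 * t)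
          \<le> (sin (\<rho> * t))\<^sup>2 / \<rho>"
        by linarith
      show "0 \<le> (sin (\<rho> * t))\<^sup>2 / \<rho>"
        using pos[OF \<rho>] by simp
    qed
    also have "\<dots> \<le> (\<integral>\<^sup>+\<rho>\<in>{0..r}. ennreal (\<rho> ^ (n - 1) * wave_kernel s t \<rho>) \<partial>lborel)"
    proof (rule nn_integral_mono)
      fix \<rho>
      show "ennreal ((sin (\<rho> * t))\<^sup>2 / \<rho>) * indicator {1/t..r} \<rho>
          \<le> ennreal (\<rho> ^ (n - 1) * wave_kernel s t \<rho>) * indicator {0..r} \<rho>"
      proof (cases "\<rho> \<in> {1/t..r}")
        case True
        then have "0 < \<rho>"
          using t by (auto intro: less_le_trans[of 0 "1 / t"])
        then have "(sin (\<rho> * t))\<^sup>2 / \<rho> = \<rho> ^ (n - 1) * wave_kernel s t \<rho>"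
          unfolding radial_weight_eq[OF \<open>0 < \<rho>\<close> n] using s by (simp add: powr_minus_divide)
        then show ?thesis
          using True \<open>0 < \<rho>\<close> by simp
      qed simp
    qed
    finally show ?case .
  qed
qed simp

text \<open>No growth is expected, so the shell r/2 \<le> \<rho> \<le> r suffices: for r t \<ge> 4
  the oscillation is fast enough for the square of the sine to keep a fixed share of its
  mean.\<close>

lemma radial_lower_supercritical:
  assumes n: "1 \<le> n" and s: "2 + 2 * s < real n" and r: "0 < r"
  shows "\<forall>\<^sub>F t in at_top. ennreal ((r / 2) powr (real n - 2 - 2 * s) / 8)
    \<le> (\<integral>\<^sup>+\<rho>\<in>{0..r}. ennreal (\<rho> ^ (n - 1) * wave_kernel s t \<rho>) \<partial>lborel)"
  using eventually_ge_at_top[of "4 / r"]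
proof eventually_elim
  case (elim t)
  define q where "q = real n - 2 - 2 * s"
  have q: "0 < q"
    using s by (simp add: q_def)
  have t: "0 < t" "4 \<le> r * t"
    using elim r by (auto simp: field_simps intro: less_le_trans[of 0 "4 / r"])
  \<comment> \<open>A lower bound for \<rho>^(q - 1) on the shell: numerator at r / 2, denominator
    at r. It is valid whatever the sign of q - 1.\<close>
  define w where "w = (r / 2) powr q / r"
  have w: "0 < w"
    using r by (simp add: w_def)
  define G where "G = (\<lambda>\<rho>. w * (\<rho> / 2 - sin (2 * (\<rho> * t)) / (4 * t)))"
  \<comment> \<open>The mean contributes r / 4, and each of the two boundary sines costs at most 1 /
    (4 t) \<le> r / 16.\<close>
  have "w * (r / 8) \<le> G r - G (r / 2)"
  proof -
    have "sin (2 * (r * t)) / (4 * t) \<le> 1 / (4 * t)"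
      using t by (intro divide_right_mono) auto
    moreover have "- 1 / (4 * t) \<le> sin (2 * (r / 2 * t)) / (4 * t)"
      using t by (intro divide_right_mono) auto
    moreover have "1 / (4 * t) \<le> r / 16"
      using t by (simp add: field_simps)
    ultimately have "r / 8 \<le> (r / 2 - sin (2 * (r * t)) / (4 * t)) - (r / 2 / 2 - sin (2 * (r / 2 * t)) / (4 * t))"
      by linarith
    then have "w * (r / 8) \<le> w * ((r / 2 - sin (2 * (r * t)) / (4 * t)) - (r / 2 / 2 - sin (2 * (r / 2 * t)) / (4 * t)))"
      using w by (intro mult_left_mono) auto
    then show ?thesis
      unfolding G_def right_diff_distrib[symmetric] .
  qed
  then have "ennreal ((r / 2) powr q / 8) \<le> ennreal (G r - G (r / 2))"
    using r by (intro ennreal_leI) (simp add: w_def)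
  also have "\<dots> \<le> (\<integral>\<^sup>+\<rho>\<in>{r/2..r}. ennreal (w * (sin (\<rho> * t))\<^sup>2) \<partial>lborel)"
  proof (rule nn_integral_Icc_ge)
    fix \<rho>
    show "(G has_real_derivative w * (1 / 2 - cos (2 * (\<rho> * t)) / 2)) (at \<rho>)"
      unfolding G_def using t by (auto intro!: derivative_eq_intros simp: field_simps)
    show "w * (1 / 2 - cos (2 * (\<rho> * t)) / 2) \<le> w * (sin (\<rho> * t))\<^sup>2"
      by (subst cos_double_sin) (simp add: field_simps)
  qed (use r w in \<open>auto intro!: continuous_intros\<close>)
  also have "\<dots> \<le> (\<integral>\<^sup>+\<rho>\<in>{0..r}. ennreal (\<rho> ^ (n - 1) * wave_kernel s t \<rho>) \<partial>lborel)"
  proof (rule nn_integral_mono)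
    fix \<rho>
    show "ennreal (w * (sin (\<rho> * t))\<^sup>2) * indicator {r/2..r} \<rho>
        \<le> ennreal (\<rho> ^ (n - 1) * wave_kernel s t \<rho>) * indicator {0..r} \<rho>"
    proof (cases "\<rho> \<in> {r/2..r}")
      case True
      then have \<rho>: "0 < \<rho>" "r / 2 \<le> \<rho>" "\<rho> \<le> r"
        using r by auto
      have "w \<le> \<rho> powr q / \<rho>"
        unfolding w_def using \<rho> r q by (intro frac_le powr_mono2) auto
      also have "\<dots> = \<rho> powr (real n - 3 - 2 * s)"
        using \<rho> powr_diff[of \<rho> q 1] by (simp add: q_def algebra_simps)
      finally have "w * (sin (\<rho> * t))\<^sup>2 \<le> \<rho> ^ (n - 1) * wave_kernel s t \<rho>"
        unfolding radial_weight_eq[OF \<rho>(1) n] by (subst mult.commute) (intro mult_left_mono, auto)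
      then show ?thesis
        using True \<rho> by (simp add: ennreal_leI)
    qed simp
  qed
  finally show ?case
    by (simp add: q_def)
qed

text \<open>The term \<open>A * r ^ n\<close> will absorb the contribution of \<open>u\<^sub>0\<close>. It is dominated because
  the rate tends to infinity or, when the rate is constant, because the left-over integral is of
  order \<open>r powr (n - 2 - 2 * s)\<close>.\<close>

lemma radial_lower:
  assumes n: "1 \<le> n" and s: "0 \<le> s" "2 * s < real n" and c: "0 < c" and A: "0 \<le> A" and r0: "0 < r0"
  shows "\<exists>r\<in>{0<..r0}. \<exists>\<kappa>>0. \<forall>\<^sub>F t in at_top. ennreal (\<kappa> * (D_rate n s t)\<^sup>2 + A * r ^ n)
    \<le> ennreal c * (\<integral>\<^sup>+\<rho>\<in>{0..r}. ennreal (\<rho> ^ (n - 1) * wave_kernel s t \<rho>) \<partial>lborel)"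
proof (cases "real n \<le> 2 + 2 * s")
  case True
  have "\<exists>\<kappa>>0. \<forall>\<^sub>F t in at_top. ennreal (\<kappa> * (D_rate n s t)\<^sup>2)
    \<le> (\<integral>\<^sup>+\<rho>\<in>{0..r0}. ennreal (\<rho> ^ (n - 1) * wave_kernel s t \<rho>) \<partial>lborel)"
    using True radial_lower_subcritical[OF n s(2) _ r0] radial_lower_critical[OF n _ r0, of s]
    by (cases "real n = 2 + 2 * s") auto
  then obtain \<kappa> where \<kappa>: "\<kappa> > 0" and ev: "\<forall>\<^sub>F t in at_top. ennreal (\<kappa> * (D_rate n s t)\<^sup>2)
    \<le> (\<integral>\<^sup>+\<rho>\<in>{0..r0}. ennreal (\<rho> ^ (n - 1) * wave_kernel s t \<rho>) \<partial>lborel)"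
    by blast
  \<comment> \<open>Beyond this threshold the term A r0^n uses up at most half of the lower
    bound.\<close>
  have "\<forall>\<^sub>F t in at_top. 2 * A * r0 ^ n / (c * \<kappa>) \<le> (D_rate n s t)\<^sup>2"
    using D_rate_power2_at_top[OF True] by (simp add: filterlim_at_top)
  with ev have "\<forall>\<^sub>F t in at_top. ennreal (c * \<kappa> / 2 * (D_rate n s t)\<^sup>2 + A * r0 ^ n)
    \<le> ennreal c * (\<integral>\<^sup>+\<rho>\<in>{0..r0}. ennreal (\<rho> ^ (n - 1) * wave_kernel s t \<rho>) \<partial>lborel)"
  proof eventually_elim
    case (elim t)
    have "A * r0 ^ n \<le> c * \<kappa> / 2 * (D_rate n s t)\<^sup>2"
      using elim(2) c \<kappa> by (simp add: field_simps)
    then have "ennreal (c * \<kappa> / 2 * (D_rate n s t)\<^sup>2 + A * r0 ^ n) \<le> ennreal (c * (\<kappa> * (D_rate n s t)\<^sup>2))"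
      by (intro ennreal_leI) simp
    also have "\<dots> = ennreal c * ennreal (\<kappa> * (D_rate n s t)\<^sup>2)"
      using c \<kappa> by (intro ennreal_mult) auto
    also have "\<dots> \<le> ennreal c * (\<integral>\<^sup>+\<rho>\<in>{0..r0}. ennreal (\<rho> ^ (n - 1) * wave_kernel s t \<rho>) \<partial>lborel)"
      by (intro mult_left_mono elim(1)) auto
    finally show ?case .
  qed
  moreover have "c * \<kappa> / 2 > 0"
    using c \<kappa> by simp
  ultimately show ?thesis
    using r0 by (intro bexI[of _ r0] exI[of _ "c * \<kappa> / 2"] conjI) simp_all
next
  case False
  define q where "q = real n - 2 - 2 * s"
  \<comment> \<open>With this choice \<open>c\<close> times the supercritical lower bound equals
    \<beta> r^q.\<close>
  define \<beta> where "\<beta> = c / (8 * 2 powr q)"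
  have \<beta>: "\<beta> > 0"
    using c by (simp add: \<beta>_def)
  \<comment> \<open>r \<le> \<beta> / (2 A + 1) yields A r \<le> \<beta> / 2, and the summand 1
    keeps the quotient meaningful for A = 0. r \<le> 1 allows r^n \<le> r^(1 + q), because 1 + q = n
    - 1 - 2 s \<le> n.\<close>
  define r where "r = min (min r0 1) (\<beta> / (2 * A + 1))"
  have r: "0 < r" "r \<le> r0" "r \<le> 1" "r \<le> \<beta> / (2 * A + 1)"
    using r0 \<beta> A by (auto simp: r_def)
  have D: "(D_rate n s t)\<^sup>2 = 1" for t
    using False by (simp add: D_rate_def)
  have Ar: "A * r ^ n \<le> \<beta> * r powr q / 2"
  proof -
    have "A * r \<le> \<beta> / 2"
    proof -
      have "r * (2 * A + 1) \<le> \<beta>"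
        using r(4) A by (simp add: pos_le_divide_eq)
      then have "2 * (A * r) + r \<le> \<beta>"
        by (simp add: algebra_simps)
      then show ?thesis
        using r(1) by linarith
    qed
    have "r ^ n = r powr real n"
      using r by (simp add: powr_realpow)
    also have "\<dots> \<le> r powr (1 + q)"
      using r s by (intro powr_mono') (auto simp: q_def)
    also have "\<dots> = r * r powr q"
      using r by (simp add: powr_add)
    finally have "A * r ^ n \<le> A * (r * r powr q)"
      using A by (intro mult_left_mono)
    also have "\<dots> = A * r * r powr q"
      by simp
    also have "\<dots> \<le> \<beta> / 2 * r powr q"
      using \<open>A * r \<le> \<beta> / 2\<close> by (intro mult_right_mono) auto
    finally show ?thesis
      by simp
  qed
  have "\<forall>\<^sub>F t in at_top. ennreal (\<beta> * r powr q / 2 * (D_rate n s t)\<^sup>2 + A * r ^ n)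
    \<le> ennreal c * (\<integral>\<^sup>+\<rho>\<in>{0..r}. ennreal (\<rho> ^ (n - 1) * wave_kernel s t \<rho>) \<partial>lborel)"
  proof (rule eventually_mono)
    show "\<forall>\<^sub>F t in at_top. ennreal ((r / 2) powr (real n - 2 - 2 * s) / 8)
      \<le> (\<integral>\<^sup>+\<rho>\<in>{0..r}. ennreal (\<rho> ^ (n - 1) * wave_kernel s t \<rho>) \<partial>lborel)"
      using False by (intro radial_lower_supercritical n r) auto
    fix t
    assume le: "ennreal ((r / 2) powr (real n - 2 - 2 * s) / 8)
      \<le> (\<integral>\<^sup>+\<rho>\<in>{0..r}. ennreal (\<rho> ^ (n - 1) * wave_kernel s t \<rho>) \<partial>lborel)"
    have "\<beta> * r powr q / 2 * (D_rate n s t)\<^sup>2 + A * r ^ n \<le> c * ((r / 2) powr q / 8)"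
      using Ar r by (simp add: D \<beta>_def powr_divide)
    then have "ennreal (\<beta> * r powr q / 2 * (D_rate n s t)\<^sup>2 + A * r ^ n) \<le> ennreal (c * ((r / 2) powr q / 8))"
      by (rule ennreal_leI)
    also have "\<dots> = ennreal c * ennreal ((r / 2) powr q / 8)"
      using c by (intro ennreal_mult) auto
    also have "\<dots> \<le> ennreal c * (\<integral>\<^sup>+\<rho>\<in>{0..r}. ennreal (\<rho> ^ (n - 1) * wave_kernel s t \<rho>) \<partial>lborel)"
      using le by (intro mult_left_mono) (auto simp: q_def)
    finally show "ennreal (\<beta> * r powr q / 2 * (D_rate n s t)\<^sup>2 + A * r ^ n)
      \<le> ennreal c * (\<integral>\<^sup>+\<rho>\<in>{0..r}. ennreal (\<rho> ^ (n - 1) * wave_kernel s t \<rho>) \<partial>lborel)" .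
  qed
  moreover have "\<beta> * r powr q / 2 > 0"
    using \<beta> r by simp
  ultimately show ?thesis
    using r by (intro bexI[of _ r] exI[of _ "\<beta> * r powr q / 2"] conjI) simp_all
qed

text \<open>For \<rho> below 1 and 1 / t the weight is at least t^2 / (4 \<rho>), so the integral
  diverges at least logarithmically at 0.\<close>

lemma radial_blow_up:
  assumes n: "1 \<le> n" and s: "real n \<le> 2 * s" and r: "0 < r" and t: "0 < t"
  shows "(\<integral>\<^sup>+\<rho>\<in>{0..r}. ennreal (\<rho> ^ (n - 1) * wave_kernel s t \<rho>) \<partial>lborel) = \<infinity>"
proof -
  define R where "R = min 1 (min r (1 / t))"
  have R: "0 < R" "R \<le> 1" "R \<le> r" "R \<le> 1 / t"
    using r t by (auto simp: R_def)
  let ?I = "\<integral>\<^sup>+\<rho>\<in>{0..r}. ennreal (\<rho> ^ (n - 1) * wave_kernel s t \<rho>) \<partial>lborel"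
  have "ennreal (t\<^sup>2 / 4 * real k) \<le> ?I" for k :: nat
  proof -
    \<comment> \<open>The logarithmic integral over [R exp (- k), R] equals k.\<close>
    define e where "e = R * exp (- real k)"
    have e: "0 < e" "e \<le> R"
      using R by (auto simp: e_def mult_left_le)
    have "ln e = ln R - real k"
      using R by (simp add: e_def ln_mult)
    then have "t\<^sup>2 / 4 * real k = t\<^sup>2 / 4 * ln R - t\<^sup>2 / 4 * ln e"
      by (simp add: right_diff_distrib)
    then have "ennreal (t\<^sup>2 / 4 * real k) \<le> (\<integral>\<^sup>+\<rho>\<in>{e..R}. ennreal (t\<^sup>2 / 4 / \<rho>) \<partial>lborel)"
      using e by (simp only:, intro nn_integral_Icc_ge[where g="\<lambda>\<rho>. t\<^sup>2 / 4 / \<rho>"])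
        (auto intro!: continuous_intros derivative_eq_intros)
    also have "\<dots> \<le> ?I"
    proof (rule nn_integral_mono)
      fix \<rho>
      show "ennreal (t\<^sup>2 / 4 / \<rho>) * indicator {e..R} \<rho>
          \<le> ennreal (\<rho> ^ (n - 1) * wave_kernel s t \<rho>) * indicator {0..r} \<rho>"
      proof (cases "\<rho> \<in> {e..R}")
        case True
        then have \<rho>: "0 < \<rho>" "\<rho> \<le> R"
          using e by auto
        have "1 / \<rho> = \<rho> powr (- 1)"
          using \<rho> by (simp add: powr_minus_divide)
        also have "\<dots> \<le> \<rho> powr (real n - 1 - 2 * s)"
          using \<rho> R s by (intro powr_mono') auto
        finally have "t\<^sup>2 / 4 * (1 / \<rho>) \<le> t\<^sup>2 / 4 * \<rho> powr (real n - 1 - 2 * s)"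
          by (intro mult_left_mono) auto
        also have "\<dots> \<le> \<rho> ^ (n - 1) * wave_kernel s t \<rho>"
        proof (rule radial_weight_ge[OF \<rho>(1) n t])
          show "\<rho> * t \<le> 1"
            using \<rho> R t by (simp add: pos_le_divide_eq[symmetric])
        qed
        finally show ?thesis
          using True \<rho> R by (simp add: ennreal_leI)
      qed simp
    qed
    finally show ?thesis .
  qed
  show ?thesis
  proof (rule ccontr)
    assume "?I \<noteq> \<infinity>"
    then obtain x where x: "0 \<le> x" "?I = ennreal x"
      by (cases ?I) auto
    obtain k :: nat where "x / (t\<^sup>2 / 4) < real k"
      using reals_Archimedean2 by blast
    then have "x < t\<^sup>2 / 4 * real k"
      using t by (simp add: field_simps)
    then show False
      using \<open>ennreal (t\<^sup>2 / 4 * real k) \<le> ?I\<close> x by (simp add: ennreal_le_iff)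
  qed
qed

section \<open>Estimates for the wave equation\<close>

definition velocity_part :: "('a::euclidean_space \<Rightarrow> complex) \<Rightarrow> real \<Rightarrow> 'a \<Rightarrow> complex" where
  "velocity_part v t \<xi> = complex_of_real (sin (norm \<xi> * t) / norm \<xi>) * v \<xi>"

definition position_part :: "('a::euclidean_space \<Rightarrow> complex) \<Rightarrow> real \<Rightarrow> 'a \<Rightarrow> complex" where
  "position_part u t \<xi> = complex_of_real (cos (norm \<xi> * t)) * fourier_L2 u \<xi>"

lemma wave_hat_eq: "wave_hat u v t \<xi> = position_part u t \<xi> + velocity_part v t \<xi>"
  by (simp add: wave_hat_def position_part_def velocity_part_def)

lemma velocity_part_measurable:
  fixes v :: "'a::euclidean_space \<Rightarrow> complex"
  assumes "has_nabla s v w"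
  shows "velocity_part v t \<in> borel_measurable lebesgue"
proof -
  have "(\<lambda>\<xi>::'a. complex_of_real (sin (norm \<xi> * t) / norm \<xi>)) \<in> borel_measurable lebesgue"
    by (rule measurable_completion) measurable
  then show ?thesis
    using assms unfolding velocity_part_def[abs_def] has_nabla_def
    by (intro borel_measurable_times) auto
qed

lemma position_part_measurable:
  fixes u :: "'a::euclidean_space \<Rightarrow> complex"
  assumes "u \<in> L2"
  shows "position_part u t \<in> borel_measurable lebesgue"
proof -
  have "(\<lambda>\<xi>::'a. complex_of_real (cos (norm \<xi> * t))) \<in> borel_measurable lebesgue"
    by (rule measurable_completion) measurable
  moreover have "fourier_L2 u \<in> borel_measurable lebesgue"
    using has_fourier_L2_fourier_L2[OF assms] by (simp add: has_fourier_L2_def L2_iff)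
  ultimately show ?thesis
    unfolding position_part_def[abs_def] by (intro borel_measurable_times)
qed

lemma cmod_position_part_le: "cmod (position_part u t \<xi>) \<le> cmod (fourier_L2 u \<xi>)"
  by (simp add: position_part_def norm_mult mult_left_le_one_le)

lemma position_part_set_le:
  "(\<integral>\<^sup>+\<xi>\<in>B. ennreal ((cmod (position_part u t \<xi>))\<^sup>2) \<partial>lebesgue)
    \<le> (\<integral>\<^sup>+\<xi>\<in>B. ennreal ((cmod (fourier_L2 u \<xi>))\<^sup>2) \<partial>lebesgue)"
  by (intro nn_integral_mono mult_right_mono ennreal_leI power_mono cmod_position_part_le) auto

text \<open>Away from the origin |\<xi>|^s can be divided out, which replaces \<open>v\<close> by
  the transform of the integrable function \<open>w\<close>. The relation in
  \<open>has_nabla\<close> itself holds only almost everywhere.\<close>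

lemma velocity_part_AE:
  fixes v :: "'a::euclidean_space \<Rightarrow> complex"
  assumes "has_nabla s v w"
  shows "AE \<xi> in lebesgue. (cmod (velocity_part v t \<xi>))\<^sup>2 = wave_kernel s t (norm \<xi>) * (cmod (fourier w \<xi>))\<^sup>2"
proof -
  have "AE \<xi> in lebesgue. \<xi> \<noteq> (0::'a)"
    by (intro AE_completion AE_lborel_singleton)
  moreover have "AE \<xi> in lebesgue. complex_of_real (norm \<xi> powr s) * v \<xi> = fourier w \<xi>"
    using assms by (simp add: has_nabla_def)
  ultimately show ?thesis
  proof eventually_elim
    case (elim \<xi>)
    have "cmod (fourier w \<xi>) = norm \<xi> powr s * cmod (v \<xi>)"
      by (simp add: norm_mult flip: elim(2))
    moreover have "norm \<xi> powr (- 2 * s) * (norm \<xi> powr s)\<^sup>2 = 1"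
      using elim(1) unfolding power2_eq_square powr_add[symmetric] by simp
    ultimately have "wave_kernel s t (norm \<xi>) * (cmod (fourier w \<xi>))\<^sup>2 = (sin (norm \<xi> * t) / norm \<xi>)\<^sup>2 * (cmod (v \<xi>))\<^sup>2"
      by (simp add: wave_kernel_def power_mult_distrib mult_ac)
    then show ?case
      by (simp add: velocity_part_def norm_mult power_mult_distrib norm_divide power_divide)
  qed
qed

lemma velocity_part_set_integral:
  assumes "has_nabla s v w"
  shows "(\<integral>\<^sup>+\<xi>\<in>B. ennreal ((cmod (velocity_part v t \<xi>))\<^sup>2) \<partial>lebesgue)
    = (\<integral>\<^sup>+\<xi>\<in>B. ennreal (wave_kernel s t (norm \<xi>)) * ennreal ((cmod (fourier w \<xi>))\<^sup>2) \<partial>lebesgue)"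
  using velocity_part_AE[OF assms, of t]
  by (intro nn_integral_cong_AE) (auto elim!: eventually_mono simp: ennreal_mult wave_kernel_nonneg)

lemma cball_lebesgue: "cball (0::'a::euclidean_space) r \<in> sets lebesgue"
  by (rule lmeasurable_cball[THEN fmeasurableD])

lemma wave_kernel_le_1:
  assumes "0 \<le> s" "1 \<le> r"
  shows "wave_kernel s t r \<le> 1"
proof -
  have "\<bar>sin (r * t) / r\<bar> \<le> 1"
    using assms order.trans[OF abs_sin_le_one[of "r * t"] assms(2)] by (simp add: abs_divide)
  moreover have "r powr (- 2 * s) \<le> r powr 0"
    using assms by (intro powr_mono) auto
  ultimately show ?thesis
    using assms by (auto simp: wave_kernel_def abs_square_le_1 intro: mult_le_one)
qed

text \<open>Frequencies are split at |\<xi>| = 1: inside, Fw is bounded by the L1 norm and the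
  kernel is integrated; outside, the kernel is at most 1 and Plancherel's inequality
  applies.\<close>

lemma velocity_part_L2sq_le:
  fixes v w :: "'a::euclidean_space \<Rightarrow> complex"
  assumes v: "has_nabla s v w" and s: "0 \<le> s"
  shows "L2sq (velocity_part v t)
    \<le> (L1norm w)\<^sup>2 * (\<integral>\<^sup>+\<xi>\<in>cball 0 1. ennreal (wave_kernel s t (norm (\<xi>::'a))) \<partial>lebesgue)
      + ennreal ((2 * pi) ^ DIM('a)) * L2sq w"
proof -
  have w: "w \<in> L1"
    using v by (simp add: has_nabla_def)
  have [measurable]: "cball (0::'a) 1 \<in> sets lebesgue"
    by (rule cball_lebesgue)
  have [measurable]: "fourier w \<in> borel_measurable lebesgue"
    using w by (intro fourier_measurable) (simp add: L1_def)
  have k[measurable]: "(\<lambda>\<xi>::'a. wave_kernel s t (norm \<xi>)) \<in> borel_measurable lebesgue"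
    by (rule measurable_completion) measurable
  have "L2sq (velocity_part v t)
      = (\<integral>\<^sup>+\<xi>. ennreal (wave_kernel s t (norm \<xi>)) * ennreal ((cmod (fourier w \<xi>))\<^sup>2) \<partial>lebesgue)"
    using velocity_part_set_integral[OF v, where B=UNIV and t=t] by (simp add: L2sq_def)
  also have "\<dots> \<le> (\<integral>\<^sup>+\<xi>. (L1norm w)\<^sup>2 * (ennreal (wave_kernel s t (norm \<xi>)) * indicator (cball 0 1) \<xi>)
      + ennreal ((cmod (fourier w \<xi>))\<^sup>2) \<partial>lebesgue)"
  proof (rule nn_integral_mono)
    fix \<xi> :: 'a
    show "ennreal (wave_kernel s t (norm \<xi>)) * ennreal ((cmod (fourier w \<xi>))\<^sup>2)
      \<le> (L1norm w)\<^sup>2 * (ennreal (wave_kernel s t (norm \<xi>)) * indicator (cball 0 1) \<xi>)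
        + ennreal ((cmod (fourier w \<xi>))\<^sup>2)"
    proof (cases "\<xi> \<in> cball 0 1")
      case True
      have "ennreal ((cmod (fourier w \<xi>))\<^sup>2) \<le> (L1norm w)\<^sup>2"
        using cmod_fourier_le[of w \<xi>] by (auto simp: power2_eq_square ennreal_mult intro: mult_mono)
      then have "ennreal (wave_kernel s t (norm \<xi>)) * ennreal ((cmod (fourier w \<xi>))\<^sup>2)
          \<le> (L1norm w)\<^sup>2 * ennreal (wave_kernel s t (norm \<xi>))"
        by (subst mult.commute) (intro mult_right_mono, auto)
      then show ?thesis
        using True by (simp add: add_increasing2)
    next
      case False
      then have "wave_kernel s t (norm \<xi>) \<le> 1"
        by (intro wave_kernel_le_1 s) auto
      then have "ennreal (wave_kernel s t (norm \<xi>)) * ennreal ((cmod (fourier w \<xi>))\<^sup>2)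
          \<le> 1 * ennreal ((cmod (fourier w \<xi>))\<^sup>2)"
        by (intro mult_right_mono) auto
      then show ?thesis
        using False by simp
    qed
  qed
  also have "\<dots> = (L1norm w)\<^sup>2 * (\<integral>\<^sup>+\<xi>\<in>cball 0 1. ennreal (wave_kernel s t (norm (\<xi>::'a))) \<partial>lebesgue)
      + L2sq (fourier w)"
    by (simp add: nn_integral_add nn_integral_cmult L2sq_def)
  also have "\<dots> \<le> (L1norm w)\<^sup>2 * (\<integral>\<^sup>+\<xi>\<in>cball 0 1. ennreal (wave_kernel s t (norm (\<xi>::'a))) \<partial>lebesgue)
      + ennreal ((2 * pi) ^ DIM('a)) * L2sq w"
    by (intro add_left_mono fourier_plancherel_le w)
  finally show ?thesis .
qed

lemma D_rate_ge_1:
  assumes "t \<ge> exp 1"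
  shows "D_rate n s t \<ge> 1"
proof -
  have t1: "t \<ge> 1"
    using assms exp_ge_add_one_self[of 1] by linarith
  have "ln t \<ge> 1"
    using assms t1 by (subst ln_ge_iff) auto
  then show ?thesis
    using t1 by (auto simp: D_rate_def intro!: ge_one_powr_ge_zero)
qed

lemma ennreal_sqrt_le:
  assumes "a \<le> ennreal (x\<^sup>2)" "0 \<le> x"
  shows "ennreal_sqrt a \<le> ennreal x"
  using ennreal_sqrt_mono[OF assms(1)] assms(2) by (simp add: ennreal_sqrt_ennreal)

lemma ennreal_sqrt_ge:
  assumes "ennreal (x\<^sup>2) \<le> a" "0 \<le> x"
  shows "ennreal x \<le> ennreal_sqrt a"
  using ennreal_sqrt_mono[OF assms(1)] assms(2) by (simp add: ennreal_sqrt_ennreal)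

lemma ennreal_finite_cases:
  assumes "a < \<infinity>"
  obtains x where "0 \<le> x" "a = ennreal x"
  using assms by (cases a) auto

lemma wave_upper_bound:
  assumes s: "0 \<le> s" "s < real DIM('a::euclidean_space) / 2"
  shows "\<exists>C>0. \<exists>T>0. \<forall>(u :: 'a \<Rightarrow> complex) v w.
    u \<in> L2 \<and> has_nabla s v w \<and> w \<in> L2 \<inter> L1 \<longrightarrow>
    (\<forall>t\<ge>T. wave_L2norm u v t \<le> ennreal (C * D_rate DIM('a) s t) * (L2norm u + (L2norm w + L1norm w)))"
proof -
  let ?n = "DIM('a)" and ?p = "(2 * pi) ^ DIM('a)"
  define V where "V = real ?n * unit_ball_vol (real ?n)"
  have V: "V > 0"
    unfolding V_def by simp
  obtain C0 where C0: "C0 > 0" and kernel: "\<And>t. t \<ge> exp 1 \<Longrightarrow>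
      (\<integral>\<^sup>+r\<in>{0..1}. ennreal (r ^ (?n - 1) * wave_kernel s t r) \<partial>lborel) \<le> ennreal (C0 * (D_rate ?n s t)\<^sup>2)"
    using wave_kernel_upper_radial[of ?n s] s by (auto simp: DIM_ge_Suc0)
  \<comment> \<open>4 (2 pi)^n covers the position term and the high frequencies, 2 V C0 the low
    ones; every summand carries a factor 2 from splitting \<open>wave_hat\<close>.\<close>
  define K where "K = 4 * ?p + 2 * V * C0"
  have K: "K > 0"
    using V C0 by (auto simp: K_def intro!: add_pos_pos)
  define C where "C = (2 * pi) powr (- real ?n / 2) * sqrt K"
  have "wave_L2norm u v t \<le> ennreal (C * D_rate ?n s t) * (L2norm u + (L2norm w + L1norm w))"
    if u: "u \<in> L2" and v: "has_nabla s v w" and w: "w \<in> L2 \<inter> L1" and t: "t \<ge> exp 1"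
    for u v w :: "'a \<Rightarrow> complex" and t
  proof -
    have "L2norm u < \<infinity>"
      using u by (simp add: L2_def)
    then obtain a where a: "0 \<le> a" "L2norm u = ennreal a"
      by (rule ennreal_finite_cases)
    have "L2norm w < \<infinity>"
      using w by (simp add: L2_def)
    then obtain b where b: "0 \<le> b" "L2norm w = ennreal b"
      by (rule ennreal_finite_cases)
    have "L1norm w < \<infinity>"
      using w by (simp add: L1_def)
    then obtain d where d: "0 \<le> d" "L1norm w = ennreal d"
      by (rule ennreal_finite_cases)
    define D where "D = D_rate ?n s t"
    have D: "1 \<le> D"
      unfolding D_def by (rule D_rate_ge_1[OF t])
    have "(\<integral>\<^sup>+\<xi>\<in>cball 0 1. ennreal (wave_kernel s t (norm (\<xi>::'a))) \<partial>lebesgue) \<le> ennreal V * ennreal (C0 * D\<^sup>2)"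
      unfolding nn_integral_wave_kernel V_def[symmetric] D_def by (intro mult_left_mono kernel t) auto
    also have "\<dots> = ennreal (V * C0 * D\<^sup>2)"
      using V C0 by (simp add: ennreal_mult[symmetric] mult.assoc)
    finally have low: "(\<integral>\<^sup>+\<xi>\<in>cball 0 1. ennreal (wave_kernel s t (norm (\<xi>::'a))) \<partial>lebesgue) \<le> ennreal (V * C0 * D\<^sup>2)" .
    have vel: "L2sq (velocity_part v t) \<le> ennreal (d\<^sup>2 * (V * C0 * D\<^sup>2) + ?p * b\<^sup>2)"
    proof -
      have "L2sq (velocity_part v t) \<le> (ennreal d)\<^sup>2 * ennreal (V * C0 * D\<^sup>2) + ennreal ?p * (ennreal b)\<^sup>2"
        using velocity_part_L2sq_le[OF v s(1), of t] low
        unfolding L2norm_power2[symmetric] b(2) d(2)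
        by (elim order.trans) (intro add_right_mono mult_left_mono, auto)
      also have "\<dots> = ennreal (d\<^sup>2 * (V * C0 * D\<^sup>2) + ?p * b\<^sup>2)"
        using b(1) d(1) V C0 by (simp add: ennreal_power ennreal_mult ennreal_plus)
      finally show ?thesis .
    qed
    have pos: "L2sq (position_part u t) \<le> ennreal (2 * (?p * a\<^sup>2))"
    proof -
      have "L2sq (position_part u t) \<le> L2sq (fourier_L2 u)"
        using position_part_set_le[of u t UNIV] by (simp add: L2sq_def)
      also have "\<dots> \<le> 2 * (ennreal ?p * (ennreal a)\<^sup>2)"
        using L2sq_fourier_L2_le[OF u] by (simp add: a(2) flip: L2norm_power2)
      also have "\<dots> = ennreal (2 * (?p * a\<^sup>2))"
        using a(1) by (simp add: ennreal_power ennreal_mult)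
      finally show ?thesis .
    qed
    have "L2sq (wave_hat u v t) \<le> 2 * L2sq (position_part u t) + 2 * L2sq (velocity_part v t)"
      unfolding wave_hat_eq[abs_def]
      by (intro L2sq_add_le position_part_measurable[OF u] velocity_part_measurable[OF v])
    also have "\<dots> \<le> 2 * ennreal (2 * (?p * a\<^sup>2)) + 2 * ennreal (d\<^sup>2 * (V * C0 * D\<^sup>2) + ?p * b\<^sup>2)"
      by (intro add_mono mult_left_mono pos vel) auto
    also have "\<dots> = ennreal (2 * (2 * (?p * a\<^sup>2)) + 2 * (d\<^sup>2 * (V * C0 * D\<^sup>2) + ?p * b\<^sup>2))"
      using V C0 by (simp add: ennreal_plus ennreal_mult)
    also have "\<dots> \<le> ennreal ((sqrt K * D * (a + (b + d)))\<^sup>2)"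
    proof (rule ennreal_leI)
      \<comment> \<open>Since the rate is at least 1, the terms that do not grow in t are absorbed
        into the squared rate.\<close>
      have D2: "1 \<le> D\<^sup>2"
        using D by (simp add: one_le_power)
      let ?S = "(a + (b + d))\<^sup>2"
      have S: "a\<^sup>2 + b\<^sup>2 \<le> ?S" "d\<^sup>2 \<le> ?S"
        using a(1) b(1) d(1) by (auto simp: power2_eq_square algebra_simps intro!: add_nonneg_nonneg add_increasing)
      have "2 * (2 * (?p * a\<^sup>2)) + 2 * (d\<^sup>2 * (V * C0 * D\<^sup>2) + ?p * b\<^sup>2)
          \<le> 4 * ?p * (a\<^sup>2 + b\<^sup>2) * 1 + 2 * V * C0 * (d\<^sup>2 * D\<^sup>2)"
        by (simp add: algebra_simps)
      also have "\<dots> \<le> 4 * ?p * ?S * D\<^sup>2 + 2 * V * C0 * (?S * D\<^sup>2)"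
        using V C0 D2 S by (intro add_mono mult_mono mult_left_mono) auto
      also have "\<dots> = K * D\<^sup>2 * ?S"
        by (simp add: K_def algebra_simps)
      also have "\<dots> = (sqrt K * D * (a + (b + d)))\<^sup>2"
        using K by (simp add: power_mult_distrib)
      finally show "2 * (2 * (?p * a\<^sup>2)) + 2 * (d\<^sup>2 * (V * C0 * D\<^sup>2) + ?p * b\<^sup>2) \<le> (sqrt K * D * (a + (b + d)))\<^sup>2" .
    qed
    finally have "L2norm (wave_hat u v t) \<le> ennreal (sqrt K * D * (a + (b + d)))"
      unfolding L2norm_eq using a b d D K by (intro ennreal_sqrt_le) auto
    then have "wave_L2norm u v t \<le> ennreal ((2 * pi) powr (- real ?n / 2)) * ennreal (sqrt K * D * (a + (b + d)))"
      unfolding wave_L2norm_def plancherel_norm_def by (intro mult_left_mono) auto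
    also have "\<dots> = ennreal (C * D * (a + (b + d)))"
      by (subst ennreal_mult'[symmetric]) (auto simp: C_def mult_ac)
    also have "\<dots> = ennreal (C * D) * ennreal (a + (b + d))"
      using a b d by (intro ennreal_mult'') auto
    also have "ennreal (a + (b + d)) = L2norm u + (L2norm w + L1norm w)"
      using a b d by (simp add: ennreal_plus)
    finally show ?thesis
      by (simp add: D_def)
  qed
  moreover have "C > 0"
    using K by (simp add: C_def)
  ultimately show ?thesis
    by (intro exI[of _ C] conjI exI[of _ "exp 1"]) auto
qed

section \<open>Low frequencies and the bounds from below\<close>

lemma wL1_integrable_norm:
  fixes w :: "'a::euclidean_space \<Rightarrow> complex"
  assumes "w \<in> wL1 1"
  shows "integrable lebesgue (\<lambda>x. norm x * cmod (w x))"
proof -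
  have wm[measurable]: "w \<in> borel_measurable lebesgue"
    using assms by (simp add: wL1_def L1_def)
  have [measurable]: "(\<lambda>x::'a. norm x) \<in> borel_measurable lebesgue"
    by (rule measurable_completion) measurable
  have "(\<integral>\<^sup>+x. ennreal (norm (norm x * cmod (w x))) \<partial>lebesgue) \<le> wL1norm 1 w"
    unfolding wL1norm_def L1norm_def
    by (intro nn_integral_mono ennreal_leI)
      (auto simp: norm_mult norm_of_real intro!: mult_right_mono simp del: of_real_add)
  also have "\<dots> < \<infinity>"
    using assms by (simp add: wL1_def)
  finally show ?thesis
    by (intro integrableI_bounded) measurable
qed

text \<open>The value of Fw at 0 is the total integral, and a finite first moment \<open>M\<close>
  gives |Fw \<xi> - Fw 0| \<le> M |\<xi>| because |exp (i y) - 1| \<le> |y|.\<close>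

lemma fourier_nonvanishing_near_0:
  fixes w :: "'a::euclidean_space \<Rightarrow> complex"
  assumes w: "w \<in> wL1 1" and P: "total_integral w \<noteq> 0"
  shows "\<exists>r>0. \<forall>\<xi>. norm \<xi> \<le> r \<longrightarrow> cmod (total_integral w) / 2 \<le> cmod (fourier w \<xi>)"
proof -
  define M where "M = (\<integral>x. norm x * cmod (w x) \<partial>lebesgue)"
  have M: "0 \<le> M"
    unfolding M_def by simp
  have w1: "w \<in> L1"
    using w by (simp add: wL1_def)
  have bound: "cmod (fourier w \<xi> - total_integral w) \<le> M * norm \<xi>" for \<xi>
  proof -
    have "fourier w \<xi> - total_integral w = (\<integral>x. exp (- (\<i> * complex_of_real (x \<bullet> \<xi>))) * w x - w x \<partial>lebesgue)"
      using phase_mult_integrable[OF w1] w1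
      by (simp add: fourier_def total_integral_def L1_iff)
    also have "cmod \<dots> \<le> (\<integral>x. norm \<xi> * (norm x * cmod (w x)) \<partial>lebesgue)"
    proof (rule Bochner_Integration.integral_norm_bound_integral)
      show "integrable lebesgue (\<lambda>x. exp (- (\<i> * complex_of_real (x \<bullet> \<xi>))) * w x - w x)"
        using phase_mult_integrable[OF w1] w1 by (simp add: L1_iff)
      show "integrable lebesgue (\<lambda>x. norm \<xi> * (norm x * cmod (w x)))"
        using wL1_integrable_norm[OF w] by simp
      fix x
      have "cmod (iexp (- (x \<bullet> \<xi>)) - 1) \<le> \<bar>x \<bullet> \<xi>\<bar>"
        using iexp_approx1[of "- (x \<bullet> \<xi>)" 0] by simp
      also have "\<dots> \<le> norm x * norm \<xi>"
        by (rule Cauchy_Schwarz_ineq2)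
      finally have "cmod ((iexp (- (x \<bullet> \<xi>)) - 1) * w x) \<le> norm x * norm \<xi> * cmod (w x)"
        unfolding norm_mult by (intro mult_right_mono) auto
      then show "cmod (exp (- (\<i> * complex_of_real (x \<bullet> \<xi>))) * w x - w x) \<le> norm \<xi> * (norm x * cmod (w x))"
        by (simp add: algebra_simps)
    qed
    also have "\<dots> = M * norm \<xi>"
      by (simp add: M_def)
    finally show ?thesis .
  qed
  show ?thesis
  \<comment> \<open>The denominator contains M + 1 instead of M so that M = 0 is covered.\<close>
  proof (intro exI[of _ "cmod (total_integral w) / (2 * (M + 1))"] conjI allI impI)
    show "0 < cmod (total_integral w) / (2 * (M + 1))"
      using P M by simp
    fix \<xi> :: 'a
    assume "norm \<xi> \<le> cmod (total_integral w) / (2 * (M + 1))"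
    then have "(M + 1) * norm \<xi> \<le> cmod (total_integral w) / 2"
      using M by (simp add: field_simps)
    then have "M * norm \<xi> \<le> cmod (total_integral w) / 2"
      using norm_ge_zero[of \<xi>] unfolding distrib_right by linarith
    then show "cmod (total_integral w) / 2 \<le> cmod (fourier w \<xi>)"
      using bound[of \<xi>] norm_triangle_ineq3[of "fourier w \<xi>" "total_integral w"] by linarith
  qed
qed

lemma velocity_part_lower:
  fixes v w :: "'a::euclidean_space \<Rightarrow> complex"
  assumes v: "has_nabla s v w"
    and r: "\<And>\<xi>. norm \<xi> \<le> r \<Longrightarrow> m \<le> cmod (fourier w \<xi>)" and m: "0 \<le> m"
  shows "ennreal (m\<^sup>2 * (real DIM('a) * unit_ball_vol (real DIM('a))))
      * (\<integral>\<^sup>+\<rho>\<in>{0..r}. ennreal (\<rho> ^ (DIM('a) - 1) * wave_kernel s t \<rho>) \<partial>lborel)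
    \<le> (\<integral>\<^sup>+\<xi>\<in>cball 0 r. ennreal ((cmod (velocity_part v t \<xi>))\<^sup>2) \<partial>lebesgue)"
proof -
  have [measurable]: "cball (0::'a) r \<in> sets lebesgue"
    by (rule cball_lebesgue)
  have [measurable]: "(\<lambda>\<xi>::'a. wave_kernel s t (norm \<xi>)) \<in> borel_measurable lebesgue"
    by (rule measurable_completion) measurable
  have "ennreal (m\<^sup>2 * (real DIM('a) * unit_ball_vol (real DIM('a))))
      * (\<integral>\<^sup>+\<rho>\<in>{0..r}. ennreal (\<rho> ^ (DIM('a) - 1) * wave_kernel s t \<rho>) \<partial>lborel)
    = ennreal (m\<^sup>2) * (\<integral>\<^sup>+\<xi>\<in>cball 0 r. ennreal (wave_kernel s t (norm (\<xi>::'a))) \<partial>lebesgue)"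
    unfolding nn_integral_wave_kernel by (subst ennreal_mult) (auto simp: mult.assoc)
  also have "\<dots> = (\<integral>\<^sup>+\<xi>. ennreal (m\<^sup>2) * (ennreal (wave_kernel s t (norm (\<xi>::'a))) * indicator (cball 0 r) \<xi>) \<partial>lebesgue)"
    by (simp add: nn_integral_cmult)
  also have "\<dots> \<le> (\<integral>\<^sup>+\<xi>\<in>cball 0 r. ennreal (wave_kernel s t (norm \<xi>)) * ennreal ((cmod (fourier w \<xi>))\<^sup>2) \<partial>lebesgue)"
  proof (rule nn_integral_mono)
    fix \<xi> :: 'a
    show "ennreal (m\<^sup>2) * (ennreal (wave_kernel s t (norm \<xi>)) * indicator (cball 0 r) \<xi>)
      \<le> ennreal (wave_kernel s t (norm \<xi>)) * ennreal ((cmod (fourier w \<xi>))\<^sup>2) * indicator (cball 0 r) \<xi>"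
    proof (cases "norm \<xi> \<le> r")
      case True
      have "ennreal (m\<^sup>2) * ennreal (wave_kernel s t (norm \<xi>))
          \<le> ennreal ((cmod (fourier w \<xi>))\<^sup>2) * ennreal (wave_kernel s t (norm \<xi>))"
        using r[OF True] m by (intro mult_right_mono ennreal_leI power_mono) auto
      then show ?thesis
        using True by (simp add: mult.commute)
    qed simp
  qed
  also have "\<dots> = (\<integral>\<^sup>+\<xi>\<in>cball 0 r. ennreal ((cmod (velocity_part v t \<xi>))\<^sup>2) \<partial>lebesgue)"
    by (rule velocity_part_set_integral[OF v, symmetric])
  finally show ?thesis .
qed

text \<open>The velocity term is the wave minus the position term. Bounding it by a sum gives a
  lower bound for the wave without any subtraction in \<open>ennreal\<close>, even if the wave has
  infinite norm.\<close>

lemma velocity_part_set_le: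
  fixes u v w :: "'a::euclidean_space \<Rightarrow> complex"
  assumes u: "u \<in> L2" and v: "has_nabla s v w" and B: "B \<in> sets lebesgue"
  shows "(\<integral>\<^sup>+\<xi>\<in>B. ennreal ((cmod (velocity_part v t \<xi>))\<^sup>2) \<partial>lebesgue)
    \<le> 2 * L2sq (wave_hat u v t) + 2 * (\<integral>\<^sup>+\<xi>\<in>B. ennreal ((cmod (fourier_L2 u \<xi>))\<^sup>2) \<partial>lebesgue)"
proof -
  have um: "position_part u t \<in> borel_measurable lebesgue"
    by (rule position_part_measurable[OF u])
  have vm: "velocity_part v t \<in> borel_measurable lebesgue"
    by (rule velocity_part_measurable[OF v])
  have wm: "wave_hat u v t \<in> borel_measurable lebesgue"
    unfolding wave_hat_eq[abs_def] by (intro borel_measurable_add um vm)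
  have "(\<integral>\<^sup>+\<xi>\<in>B. ennreal ((cmod (velocity_part v t \<xi>))\<^sup>2) \<partial>lebesgue)
      = (\<integral>\<^sup>+\<xi>\<in>B. ennreal ((cmod (wave_hat u v t \<xi> + - position_part u t \<xi>))\<^sup>2) \<partial>lebesgue)"
    by (simp add: wave_hat_eq)
  also have "\<dots> \<le> 2 * (\<integral>\<^sup>+\<xi>\<in>B. ennreal ((cmod (wave_hat u v t \<xi>))\<^sup>2) \<partial>lebesgue)
      + 2 * (\<integral>\<^sup>+\<xi>\<in>B. ennreal ((cmod (- position_part u t \<xi>))\<^sup>2) \<partial>lebesgue)"
    by (intro set_L2sq_add_le wm borel_measurable_uminus um B)
  also have "\<dots> \<le> 2 * L2sq (wave_hat u v t) + 2 * (\<integral>\<^sup>+\<xi>\<in>B. ennreal ((cmod (fourier_L2 u \<xi>))\<^sup>2) \<partial>lebesgue)"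
  proof (intro add_mono mult_left_mono)
    show "(\<integral>\<^sup>+\<xi>\<in>B. ennreal ((cmod (wave_hat u v t \<xi>))\<^sup>2) \<partial>lebesgue) \<le> L2sq (wave_hat u v t)"
      unfolding L2sq_def by (intro nn_integral_mono) (auto split: split_indicator)
  qed (use position_part_set_le[of u t B] in auto)
  finally show ?thesis .
qed

lemma wave_lower_bound:
  fixes u v w :: "'a::euclidean_space \<Rightarrow> complex"
  assumes s: "0 \<le> s" "s < real DIM('a) / 2"
    and u: "u \<in> L2 \<inter> L1" and v: "has_nabla s v w" and w: "w \<in> wL1 1" and P: "total_integral w \<noteq> 0"
  shows "\<exists>c>0. \<exists>T>0. \<forall>t\<ge>T. wave_L2norm u v t \<ge> ennreal (c * D_rate DIM('a) s t * cmod (total_integral w))"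
proof -
  let ?n = "DIM('a)" and ?P = "cmod (total_integral w)"
  define V where "V = unit_ball_vol (real ?n)"
  have V: "V > 0"
    unfolding V_def by simp
  obtain r0 where r0: "r0 > 0" and low: "\<And>\<xi>. norm \<xi> \<le> r0 \<Longrightarrow> ?P / 2 \<le> cmod (fourier w \<xi>)"
    using fourier_nonvanishing_near_0[OF w P] by blast
  have "L1norm u < \<infinity>"
    using u by (simp add: L1_def)
  then obtain a where a: "0 \<le> a" "L1norm u = ennreal a"
    by (rule ennreal_finite_cases)
  have "0 < (?P / 2)\<^sup>2 * (real ?n * V)"
    using P V by simp
  \<comment> \<open>4 a^2 V r^n is the bound for the position term on the ball of radius
    \<open>r\<close>. As \<open>r\<close> is at most \<open>r0\<close>, the lower bound for Fw
    remains available there.\<close>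
  then obtain r \<kappa> where r: "0 < r" "r \<le> r0" and \<kappa>: "\<kappa> > 0"
    and ev: "\<forall>\<^sub>F t in at_top. ennreal (\<kappa> * (D_rate ?n s t)\<^sup>2 + 4 * a\<^sup>2 * V * r ^ ?n)
      \<le> ennreal ((?P / 2)\<^sup>2 * (real ?n * V)) * (\<integral>\<^sup>+\<rho>\<in>{0..r}. ennreal (\<rho> ^ (?n - 1) * wave_kernel s t \<rho>) \<partial>lborel)"
    using radial_lower[of ?n s "(?P / 2)\<^sup>2 * (real ?n * V)" "4 * a\<^sup>2 * V" r0] s r0 V
    by (auto simp: DIM_ge_Suc0)
  \<comment> \<open>Division by |P| cancels the factor |P| in the claim; the constant may depend on
    the data.\<close>
  define c where "c = (2 * pi) powr (- real ?n / 2) * sqrt (\<kappa> / 2) / ?P"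
  have c: "c > 0"
    using \<kappa> P by (simp add: c_def)
  have "\<forall>\<^sub>F t in at_top. ennreal (c * D_rate ?n s t * ?P) \<le> wave_L2norm u v t"
    using ev eventually_ge_at_top[of "exp 1"]
  proof eventually_elim
    case (elim t)
    define D where "D = D_rate ?n s t"
    have D: "0 \<le> D"
      using D_rate_ge_1[OF elim(2), of ?n s] by (simp add: D_def)
    have "ennreal (\<kappa> * D\<^sup>2) + ennreal (4 * a\<^sup>2 * V * r ^ ?n) = ennreal (\<kappa> * D\<^sup>2 + 4 * a\<^sup>2 * V * r ^ ?n)"
      using \<kappa> V r by (intro ennreal_plus[symmetric]) auto
    also have "\<dots> \<le> (\<integral>\<^sup>+\<xi>\<in>cball 0 r. ennreal ((cmod (velocity_part v t \<xi>))\<^sup>2) \<partial>lebesgue)"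
      using elim(1) velocity_part_lower[OF v, of r "?P / 2" t] low r
      unfolding D_def V_def by (auto intro: order.trans)
    also have "\<dots> \<le> 2 * L2sq (wave_hat u v t) + 2 * (\<integral>\<^sup>+\<xi>\<in>cball 0 r. ennreal ((cmod (fourier_L2 u \<xi>))\<^sup>2) \<partial>lebesgue)"
      using u by (intro velocity_part_set_le[OF _ v] cball_lebesgue) auto
    \<comment> \<open>One factor 2 comes from splitting the wave, the other from
      \<open>fourier_L2_local_bound\<close>; the result is the finite term on the left, which then
      cancels.\<close>
    also have "\<dots> \<le> 2 * L2sq (wave_hat u v t) + 2 * (2 * ((ennreal a)\<^sup>2 * emeasure lebesgue (cball (0::'a) r)))"
      using u fourier_L2_local_bound[of u, OF _ cball_lebesgue]
      unfolding a(2)[symmetric] by (intro add_left_mono mult_left_mono) auto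
    also have "2 * (2 * ((ennreal a)\<^sup>2 * emeasure lebesgue (cball (0::'a) r))) = ennreal (4 * a\<^sup>2 * V * r ^ ?n)"
      using a r V by (simp add: emeasure_cball V_def ennreal_power ennreal_mult mult.assoc[symmetric])
    finally have "ennreal (\<kappa> * D\<^sup>2) \<le> 2 * L2sq (wave_hat u v t)"
      by (simp add: ennreal_add_left_cancel_le add.commute)
    then have "ennreal (1 / 2) * ennreal (\<kappa> * D\<^sup>2) \<le> ennreal (1 / 2) * (2 * L2sq (wave_hat u v t))"
      by (intro mult_left_mono) auto
    also have "\<dots> = (ennreal (1 / 2) * ennreal 2) * L2sq (wave_hat u v t)"
      by (simp add: mult.assoc)
    also have "ennreal (1 / 2) * ennreal 2 = 1"
      by (subst ennreal_mult[symmetric]) auto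
    also have "ennreal (1 / 2) * ennreal (\<kappa> * D\<^sup>2) = ennreal ((sqrt (\<kappa> / 2) * D)\<^sup>2)"
      using \<kappa> by (subst ennreal_mult[symmetric]) (auto simp: power_mult_distrib)
    finally have "ennreal (sqrt (\<kappa> / 2) * D) \<le> L2norm (wave_hat u v t)"
      unfolding L2norm_eq using D \<kappa> by (intro ennreal_sqrt_ge) auto
    then have "ennreal ((2 * pi) powr (- real ?n / 2)) * ennreal (sqrt (\<kappa> / 2) * D) \<le> wave_L2norm u v t"
      unfolding wave_L2norm_def plancherel_norm_def by (intro mult_left_mono) auto
    also have "ennreal ((2 * pi) powr (- real ?n / 2)) * ennreal (sqrt (\<kappa> / 2) * D) = ennreal (c * D * ?P)"
      using P by (subst ennreal_mult'[symmetric]) (auto simp: c_def mult.assoc)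
    finally show ?case
      by (simp add: D_def)
  qed
  then obtain T where "\<And>t. t \<ge> T \<Longrightarrow> ennreal (c * D_rate ?n s t * ?P) \<le> wave_L2norm u v t"
    by (auto simp: eventually_at_top_linorder)
  then show ?thesis
    using c by (intro exI[of _ c] conjI exI[of _ "max T 1"]) auto
qed

text \<open>The velocity term has infinite mass near the origin while the position term is square
  integrable, so the two cannot compensate.\<close>

lemma wave_blow_up:
  fixes u v w :: "'a::euclidean_space \<Rightarrow> complex"
  assumes s: "real DIM('a) / 2 \<le> s"
    and u: "u \<in> L2" and v: "has_nabla s v w" and w: "w \<in> wL1 1" and P: "total_integral w \<noteq> 0"
    and t: "0 < t"
  shows "wave_L2norm u v t = \<infinity>"
proof -
  let ?n = "DIM('a)" and ?P = "cmod (total_integral w)"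
  obtain r where r: "r > 0" and low: "\<And>\<xi>. norm \<xi> \<le> r \<Longrightarrow> ?P / 2 \<le> cmod (fourier w \<xi>)"
    using fourier_nonvanishing_near_0[OF w P] by blast
  have V: "unit_ball_vol (real ?n) \<noteq> 0"
    by (metis of_nat_0_le_iff order_less_irrefl unit_ball_vol_pos)
  have "(\<integral>\<^sup>+\<rho>\<in>{0..r}. ennreal (\<rho> ^ (?n - 1) * wave_kernel s t \<rho>) \<partial>lborel) = \<infinity>"
    using s r t by (intro radial_blow_up) (auto simp: DIM_ge_Suc0)
  then have inf: "(\<integral>\<^sup>+\<xi>\<in>cball 0 r. ennreal ((cmod (velocity_part v t \<xi>))\<^sup>2) \<partial>lebesgue) = \<infinity>"
    using velocity_part_lower[OF v, where r=r and m="?P / 2" and t=t] low P V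
    by (simp add: ennreal_mult_top top_unique)
  have "(\<integral>\<^sup>+\<xi>\<in>cball 0 r. ennreal ((cmod (velocity_part v t \<xi>))\<^sup>2) \<partial>lebesgue)
    \<le> 2 * L2sq (wave_hat u v t) + 2 * (\<integral>\<^sup>+\<xi>\<in>cball 0 r. ennreal ((cmod (fourier_L2 u \<xi>))\<^sup>2) \<partial>lebesgue)"
    by (intro velocity_part_set_le[OF u v] cball_lebesgue)
  also have "\<dots> \<le> 2 * L2sq (wave_hat u v t) + 2 * L2sq (fourier_L2 u)"
    unfolding L2sq_def by (intro add_left_mono mult_left_mono nn_integral_mono) (auto split: split_indicator)
  finally have "2 * L2sq (wave_hat u v t) + 2 * L2sq (fourier_L2 u) = \<infinity>"
    by (simp add: inf top_unique)
  moreover have "L2sq (fourier_L2 u) < \<infinity>"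
    using has_fourier_L2_fourier_L2[OF u] by (simp add: has_fourier_L2_def L2_iff)
  ultimately have "L2sq (wave_hat u v t) = \<infinity>"
    by (auto simp: ennreal_mult_eq_top_iff)
  then show ?thesis
    by (simp add: wave_L2norm_def plancherel_norm_def L2norm_eq ennreal_sqrt_def ennreal_mult_top)
qed

theorem theorem2p1:
  fixes s :: real
  assumes "s \<ge> 0"
  shows
    "(s < real CARD('n::finite) / 2 \<longrightarrow>
       (\<exists>C>0. \<exists>T>0. \<forall>(u\<^sub>0 :: real^'n \<Rightarrow> complex) v w.
          u\<^sub>0 \<in> L2 \<and> has_nabla s v w \<and> w \<in> L2 \<inter> L1 \<longrightarrow>
          (\<forall>t\<ge>T. wave_L2norm u\<^sub>0 v t
             \<le> ennreal (C * D_rate CARD('n) s t) * (L2norm u\<^sub>0 + (L2norm w + L1norm w)))))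
     \<and>
     (s < real CARD('n) / 2 \<longrightarrow>
       (\<forall>(u\<^sub>0 :: real^'n \<Rightarrow> complex) v w.
          u\<^sub>0 \<in> L2 \<inter> L1 \<and> has_nabla s v w \<and> w \<in> L2 \<inter> wL1 1 \<and> total_integral w \<noteq> 0 \<longrightarrow>
          (\<exists>c>0. \<exists>T>0. \<forall>t\<ge>T.
             wave_L2norm u\<^sub>0 v t \<ge> ennreal (c * D_rate CARD('n) s t * cmod (total_integral w)))))
     \<and>
     (s \<ge> real CARD('n) / 2 \<longrightarrow>
       (\<forall>(u\<^sub>0 :: real^'n \<Rightarrow> complex) v w.
          u\<^sub>0 \<in> L2 \<and> has_nabla s v w \<and> w \<in> wL1 1 \<and> total_integral w \<noteq> 0 \<longrightarrow>
          (\<forall>t\<^sub>0>0. \<forall>t\<in>{0<..t\<^sub>0}. wave_L2norm u\<^sub>0 v t = \<infinity>)))"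
proof -
  have n: "DIM(real^'n) = CARD('n)"
    by simp
  show ?thesis
    using wave_upper_bound[where 'a="real^'n" and s=s] wave_lower_bound[where 'a="real^'n" and s=s]
      wave_blow_up[where 'a="real^'n" and s=s] assms
    unfolding n by (intro conjI impI allI ballI) auto
qed

end
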